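(* Let $\mathcal{G}=\langle\mathcal{Q},\mathbf{f}\rangle$ be a P$_{\boldsymbol{\Upsilon}}$ NEP. Then $\mathcal{G}$ has a unique NE $\mathbf{x}^\star$, and every sequence $\{\mathbf{x}^{(n)}\}_{n\ge0}$ generated by the asynchronous best-response algorithm converges to $\mathbf{x}^\star$, for any updating schedule $\{\mathcal{T}_i\}$, $\{\tau_j^i(n)\}$ satisfying A1–A3.
   Context: Real NEP $\mathcal{G}=\langle\mathcal{Q},\mathbf{f}\rangle$: $I$ players; player $i$ chooses $\mathbf{x}_i\in\mathcal{Q}_i\subseteq\mathbb{R}^{n_i}$; $\mathbf{x}=(\mathbf{x}_i)_{i=1}^I$, $\mathbf{x}_{-i}=(\mathbf{x}_j)_{j\ne i}$, $\mathcal{Q}=\prod_i\mathcal{Q}_i$, $\mathcal{Q}_{-i}=\prod_{j\ne i}\mathcal{Q}_j$; player $i$ minimizes $f_i(\mathbf{x}_i,\mathbf{x}_{-i})$ over $\mathbf{x}_i\in\mathcal{Q}_i$. A NE is $\mathbf{x}^\star\in\mathcal{Q}$ with $f_i(\mathbf{x}_i^\star,\mathbf{x}^\star_{-i})\le f_i(\mathbf{x}_i,\mathbf{x}^\star_{-i})$ for all $\mathbf{x}_i\in\mathcal{Q}_i$ and all $i$. Assumption 1: each $\mathcal{Q}_i$ nonempty closed convex, each $f_i$ continuously differentiable on (an open set containing) $\mathcal{Q}$ and convex in $\mathbf{x}_i$ for every fixed $\mathbf{x}_{-i}\in\mathcal{Q}_{-i}$. Assumption 2: each $f_i$ twice continuously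 differentiable with bounded derivatives on $\mathcal{Q}$. Let $\mathbf{F}=(\mathbf{F}_i)_i$, $\mathbf{F}_i(\mathbf{x})=\nabla_{\mathbf{x}_i}f_i(\mathbf{x})$. Matrix $\boldsymbol{\Upsilon}_{\mathbf{F}}\in\mathbb{R}^{I\times I}$: for arbitrary nonsingular $\mathbf{C}_i\in\mathbb{R}^{n_i\times n_i}$, $[\boldsymbol{\Upsilon}_{\mathbf{F}}]_{ii}=\alpha_i^{\min}=\inf_{\mathbf{x}\in\mathcal{Q}}\lambda_{\rm least}(\mathbf{C}_i^T\mathbf{J}_i\mathbf{F}_i(\mathbf{x})\mathbf{C}_i)$, $[\boldsymbol{\Upsilon}_{\mathbf{F}}]_{ij}=-\beta_{ij}^{\max}=-\sup_{\mathbf{x}\in\mathcal{Q}}\|\mathbf{C}_i^T\mathbf{J}_j\mathbf{F}_i(\mathbf{x})\mathbf{C}_j\|_2$ ($i\ne j$), where $\mathbf{J}_j\mathbf{F}_i$ is the Jacobian of $\mathbf{F}_i$ w.r.t. $\mathbf{x}_j$ and $\lambda_{\rm least}(\mathbf{A})$ the smallest eigenvalue of $(\mathbf{A}+\mathbf{A}^T)/2$. $\mathcal{G}$ is a P$_{\boldsymbol{\Upsilon}}$ NEP if Assumptions 1 and 2 hold and $\boldsymbol{\Upsilon}_{\mathbf{F}}$ is a P-matrix (all principal minors positive). Asynchronous best-response algorithm: pick $\mathbf{x}^{(0)}\in\mathcal{Q}$; for $n=0,1,\dots$ and each $i$, set $\mathbf{x}_i^{(n+1)}\in\arg\min_{\mathbf{x}_i\in\mathcal{Q}_i}f_i(\mathbf{x}_i,\mathbf{x}_{-i}^{(\boldsymbol\tau^i(n))})$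 if $n\in\mathcal{T}_i$ and $\mathbf{x}_i^{(n+1)}=\mathbf{x}_i^{(n)}$ otherwise, where $\mathcal{T}_i\subseteq\{0,1,2,\dots\}$ is the set of update times of player $i$ and $\mathbf{x}_{-i}^{(\boldsymbol\tau^i(n))}=(\mathbf{x}_j^{(\tau_j^i(n))})_{j\ne i}$. Conditions: A1) $0\le\tau_j^i(n)\le n$; A2) $\lim_{k\to\infty}\tau_j^i(n_k)=+\infty$ for every sequence $\{n_k\}\subseteq\mathcal{T}_i$ tending to infinity; A3) $|\mathcal{T}_i|=\infty$. *)

theory Defs
  imports "HOL-Analysis.Analysis"
begin

text \<open>Encoding. The stacked strategy profile x = (x_1,...,x_I) lives in real^'k, where
 'k is a finite set of coordinates partitioned into player blocks by blk :: 'k => 'p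
 ('p = finite set of players).  Player i's strategy space R^{n_i} is the coordinate
 subspace blocksp blk i (coordinates k with blk k = i), n_i = card of that block.\<close>

definition blocksp :: "('k \<Rightarrow> 'p) \<Rightarrow> 'p \<Rightarrow> (real^'k) set" where
  "blocksp blk i = {v. \<forall>k. blk k \<noteq> i \<longrightarrow> v $ k = 0}"

definition proj :: "('k \<Rightarrow> 'p) \<Rightarrow> 'p \<Rightarrow> real^'k \<Rightarrow> real^'k" where
  "proj blk i x = (\<chi> k. if blk k = i then x $ k else 0)"

text \<open>Block (i,j) of a square matrix (J_j F_i when applied to the Hessian of f_i).\<close>
definition blockM :: "('k \<Rightarrow> 'p) \<Rightarrow> 'p \<Rightarrow> 'p \<Rightarrow> real^'k^'k \<Rightarrow> real^'k^'k" where
  "blockM blk i j M = (\<chi> k l. if blk k = i \<and> blk l = j then M $ k $ l else 0)"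

definition prodQ :: "('k \<Rightarrow> 'p) \<Rightarrow> ('p \<Rightarrow> (real^'k) set) \<Rightarrow> (real^'k) set" where
  "prodQ blk Q = {x. \<forall>i. proj blk i x \<in> Q i}"

definition lambda_least :: "('k \<Rightarrow> 'p) \<Rightarrow> 'p \<Rightarrow> real^'k^'k \<Rightarrow> real" where
  "lambda_least blk i A = Min {l. \<exists>v \<in> blocksp blk i. v \<noteq> 0 \<and>
       ((1/2) *\<^sub>R (A + transpose A)) *v v = l *\<^sub>R v}"

definition norm2 :: "real^'k^'k \<Rightarrow> real" where
  "norm2 M = onorm (\<lambda>v. M *v v)"

definition nonsing_block :: "('k \<Rightarrow> 'p) \<Rightarrow> 'p \<Rightarrow> real^'k^'k \<Rightarrow> bool" where
  "nonsing_block blk i C \<longleftrightarrow> blockM blk i i C = C \<and>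
      (\<forall>v \<in> blocksp blk i. C *v v = 0 \<longrightarrow> v = 0)"

definition pminor :: "('p \<Rightarrow> 'p \<Rightarrow> real) \<Rightarrow> 'p set \<Rightarrow> real" where
  "pminor M S = (\<Sum>p | p permutes S. of_int (sign p) * (\<Prod>i\<in>S. M i (p i)))"

definition P_matrix :: "('p::finite \<Rightarrow> 'p \<Rightarrow> real) \<Rightarrow> bool" where
  "P_matrix M \<longleftrightarrow> (\<forall>S. S \<noteq> {} \<longrightarrow> pminor M S > 0)"

text \<open>The matrix Upsilon_F; hess i x is the Hessian of f_i at x (so that its block (i,j)
  is J_j F_i(x)).\<close>
definition Upsilon :: "('k \<Rightarrow> 'p) \<Rightarrow> ('p \<Rightarrow> (real^'k) set) \<Rightarrow> ('p \<Rightarrow> real^'k \<Rightarrow> real^'k^'k)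
    \<Rightarrow> ('p \<Rightarrow> real^'k^'k) \<Rightarrow> 'p \<Rightarrow> 'p \<Rightarrow> real" where
  "Upsilon blk Q hess C i j =
     (if i = j then (INF x\<in>prodQ blk Q. lambda_least blk i (transpose (C i) ** blockM blk i i (hess i x) ** C i))
      else - (SUP x\<in>prodQ blk Q. norm2 (transpose (C i) ** blockM blk i j (hess i x) ** C j)))"

definition is_NE :: "('k \<Rightarrow> 'p) \<Rightarrow> ('p \<Rightarrow> (real^'k) set) \<Rightarrow> ('p \<Rightarrow> real^'k \<Rightarrow> real) \<Rightarrow> real^'k \<Rightarrow> bool" where
  "is_NE blk Q f xs \<longleftrightarrow> xs \<in> prodQ blk Q \<and>
     (\<forall>i. \<forall>y\<in>Q i. f i xs \<le> f i (y + (xs - proj blk i xs)))"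

definition async_BR_seq :: "('k \<Rightarrow> 'p::finite) \<Rightarrow> ('p \<Rightarrow> (real^'k) set) \<Rightarrow> ('p \<Rightarrow> real^'k \<Rightarrow> real)
    \<Rightarrow> ('p \<Rightarrow> nat set) \<Rightarrow> ('p \<Rightarrow> 'p \<Rightarrow> nat \<Rightarrow> nat) \<Rightarrow> (nat \<Rightarrow> real^'k) \<Rightarrow> bool" where
  "async_BR_seq blk Q f T tau x \<longleftrightarrow>
     x 0 \<in> prodQ blk Q \<and>
     (\<forall>n i. (n \<in> T i \<longrightarrow>
               (let oth = (\<Sum>j\<in>UNIV - {i}. proj blk j (x (tau i j n)))
                in proj blk i (x (Suc n)) \<in> Q i \<and>
                   (\<forall>z\<in>Q i. f i (proj blk i (x (Suc n)) + oth) \<le> f i (z + oth))))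
          \<and> (n \<notin> T i \<longrightarrow> proj blk i (x (Suc n)) = proj blk i (x n)))"

definition schedule_ok :: "('p \<Rightarrow> nat set) \<Rightarrow> ('p \<Rightarrow> 'p \<Rightarrow> nat \<Rightarrow> nat) \<Rightarrow> bool" where
  "schedule_ok T tau \<longleftrightarrow>
     (\<forall>i j n. j \<noteq> i \<longrightarrow> tau i j n \<le> n) \<and>
     (\<forall>i j nk. j \<noteq> i \<longrightarrow> (\<forall>k. nk k \<in> T i) \<longrightarrow> filterlim nk at_top sequentially \<longrightarrow>
         filterlim (\<lambda>k. tau i j (nk k)) at_top sequentially) \<and>
     (\<forall>i. infinite (T i))"

end

theory Submission
  imports Defs
begin

text \<open>For profiles \<open>x, y\<close> that both play best responses in block \<open>i\<close>, adding the two variational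
  inequalities and applying the mean value theorem to \<open>F\<^sub>i\<close> gives \<open>e\<^sub>i * (\<Upsilon> e)\<^sub>i \<le> 0\<close>, where \<open>e\<^sub>i\<close>
  is the norm of block \<open>i\<close> of \<open>x - y\<close> in the coordinates given by \<open>C\<^sub>i\<close>. Since \<open>\<Upsilon>\<close> is a P-matrix with
  nonpositive off-diagonal entries, there is \<open>d > 0\<close> with \<open>\<Upsilon> d > 0\<close>, and best responses contract in
  the maximum norm weighted by \<open>d\<close>. Such contractions converge under asynchronous updates, because
  the iterates eventually enter each of a shrinking family of boxes. Existence follows from
  Brouwer's theorem, as the strategy sets turn out to be compact.\<close>

section \<open>P-matrices\<close>

text \<open>A determinant is affine in each of its diagonal entries. Only the permutations that fix
  \<open>i\<close> meet the changed entry, and these are exactly the permutations of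
  \<open>S - {i}\<close>, so the slope is the minor on \<open>S - {i}\<close>.\<close>

lemma pminor_add_diagonal_entry:
  fixes M :: "'p::finite \<Rightarrow> 'p \<Rightarrow> real"
  assumes "i \<in> S"
  shows "pminor (\<lambda>k l. M k l + (if k = i \<and> l = i then c else 0)) S
           = pminor M S + c * pminor M (S - {i})"
proof -
  let ?N = "\<lambda>k l. M k l + (if k = i \<and> l = i then c else 0)"
  have expand: "of_int (sign p) * (\<Prod>k\<in>S. ?N k (p k)) = of_int (sign p) * (\<Prod>k\<in>S. M k (p k))
      + (if p i = i then c * (of_int (sign p) * (\<Prod>k\<in>S - {i}. M k (p k))) else 0)" for p
  proof -
    have "(\<Prod>k\<in>S. ?N k (p k)) = ?N i (p i) * (\<Prod>k\<in>S - {i}. ?N k (p k))"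
      using assms by (intro prod.remove) auto
    also have "(\<Prod>k\<in>S - {i}. ?N k (p k)) = (\<Prod>k\<in>S - {i}. M k (p k))"
      by (intro prod.cong) auto
    finally have N: "(\<Prod>k\<in>S. ?N k (p k)) = ?N i (p i) * (\<Prod>k\<in>S - {i}. M k (p k))" .
    have M: "(\<Prod>k\<in>S. M k (p k)) = M i (p i) * (\<Prod>k\<in>S - {i}. M k (p k))"
      using assms by (intro prod.remove) auto
    show ?thesis
      unfolding N M by (simp add: algebra_simps)
  qed
  have fixing: "{p. p permutes S} \<inter> {p. p i = i} = {p. p permutes (S - {i})}"
  proof (intro equalityI subsetI)
    fix p assume "p \<in> {p. p permutes S} \<inter> {p. p i = i}"
    then show "p \<in> {p. p permutes (S - {i})}"
      using permutes_superset[of p S "S - {i}"] by auto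
  next
    fix p assume "p \<in> {p. p permutes (S - {i})}"
    then have p: "p permutes (S - {i})" by simp
    show "p \<in> {p. p permutes S} \<inter> {p. p i = i}"
      using permutes_subset[OF p, of S] permutes_not_in[OF p, of i] by auto
  qed
  have "pminor ?N S = pminor M S
      + (\<Sum>p | p permutes S. if p i = i then c * (of_int (sign p) * (\<Prod>k\<in>S - {i}. M k (p k))) else 0)"
    unfolding pminor_def expand sum.distrib ..
  also have "(\<Sum>p | p permutes S. if p i = i then c * (of_int (sign p) * (\<Prod>k\<in>S - {i}. M k (p k))) else 0)
      = (\<Sum>p | p permutes (S - {i}). c * (of_int (sign p) * (\<Prod>k\<in>S - {i}. M k (p k))))"
    unfolding fixing[symmetric]
    by (subst sum.inter_restrict) (simp_all add: finite_permutations)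
  also have "\<dots> = c * pminor M (S - {i})"
    unfolding pminor_def by (simp add: sum_distrib_left)
  finally show ?thesis .
qed

lemma pminor_empty [simp]: "pminor M {} = 1"
proof -
  have "{p. p permutes {}} = {id}"
    by auto
  then show ?thesis
    by (simp add: pminor_def)
qed

text \<open>The diagonal entries are raised one after another, \<open>A\<close> being the set of
  indices treated so far. Each step adds to a principal minor a nonnegative multiple of a smaller
  one.\<close>

lemma P_matrix_add_diagonal:
  fixes M :: "'p::finite \<Rightarrow> 'p \<Rightarrow> real"
  assumes "P_matrix M" and "\<And>i. 0 \<le> c i"
  shows "P_matrix (\<lambda>k l. M k l + (if k = l then c k else 0))"
proof -
  have "P_matrix (\<lambda>k l. M k l + (if k = l \<and> k \<in> A then c k else 0))" if "finite A" for A
    using that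
  proof (induction A rule: finite_induct)
    case empty
    then show ?case using assms by simp
  next
    case (insert i A)
    let ?N = "\<lambda>k l. M k l + (if k = l \<and> k \<in> A then c k else 0)"
    let ?N' = "\<lambda>k l. ?N k l + (if k = i \<and> l = i then c i else 0)"
    have eq: "(\<lambda>k l. M k l + (if k = l \<and> k \<in> insert i A then c k else 0)) = ?N'"
      using insert.hyps by (auto simp: fun_eq_iff)
    have "pminor ?N' S > 0" if "S \<noteq> {}" for S
    proof (cases "i \<in> S")
      case True
      \<comment> \<open>The smaller minor may be the empty one, about which \<open>P_matrix\<close>
        says nothing; its value is 1.\<close>
      have "0 \<le> pminor ?N (S - {i})"
      proof (cases "S - {i} = {}")
        case True
        then show ?thesis by (simp only: pminor_empty)
      next
        case False
        show ?thesis
          using insert.IH[unfolded P_matrix_def, rule_format, OF False] by (rule less_imp_le)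
      qed
      moreover have "0 < pminor ?N S"
        using insert.IH that by (simp add: P_matrix_def)
      ultimately show ?thesis
        using assms(2)[of i] pminor_add_diagonal_entry[OF True, of ?N "c i"]
        by (simp add: add_pos_nonneg)
    next
      case False
      then have "pminor ?N' S = pminor ?N S"
        unfolding pminor_def by (intro sum.cong arg_cong2[where f="(*)"] prod.cong) auto
      then show ?thesis
        using insert.IH that by (simp add: P_matrix_def)
    qed
    then show ?case
      unfolding eq P_matrix_def by blast
  qed
  from this[of UNIV] show ?thesis by simp
qed

text \<open>Padding the submatrix on \<open>S\<close> with the identity makes determinant theory for
  the full index type available. A permutation that moves an index outside \<open>S\<close> picks up
  a zero of the padding.\<close>

lemma pminor_eq_det:
  fixes M :: "'p::finite \<Rightarrow> 'p \<Rightarrow> real"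
  shows "pminor M S = det (\<chi> i j. if i \<in> S \<and> j \<in> S then M i j else if i = j then 1 else 0)"
    (is "_ = det ?B")
proof -
  have "det ?B = (\<Sum>p | p permutes UNIV. of_int (sign p) * (\<Prod>i\<in>UNIV. ?B $ i $ p i))"
    by (simp add: det_def)
  also have "\<dots> = (\<Sum>p | p permutes S. of_int (sign p) * (\<Prod>i\<in>UNIV. ?B $ i $ p i))"
  proof (intro sum.mono_neutral_right)
    show "\<forall>p\<in>{p. p permutes UNIV} - {p. p permutes S}.
        of_int (sign p) * (\<Prod>i\<in>UNIV. ?B $ i $ p i) = 0"
    proof
      fix p assume p: "p \<in> {p. p permutes UNIV} - {p. p permutes S}"
      then obtain i where "i \<notin> S" "p i \<noteq> i"
        by (metis DiffE mem_Collect_eq permutes_superset DiffD1)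
      then have "?B $ i $ p i = 0"
        by auto
      then show "of_int (sign p) * (\<Prod>i\<in>UNIV. ?B $ i $ p i) = 0"
        by (metis (no_types, lifting) UNIV_I finite mult_eq_0_iff prod_zero)
    qed
  qed (auto intro: permutes_subset)
  also have "\<dots> = pminor M S"
    unfolding pminor_def
  proof (intro sum.cong refl arg_cong2[where f="(*)"])
    fix p assume "p \<in> {p. p permutes S}"
    then have p: "p permutes S" by simp
    have "(\<Prod>i\<in>UNIV. ?B $ i $ p i) = (\<Prod>i\<in>S. ?B $ i $ p i)"
      using p by (intro prod.mono_neutral_right) (auto simp: permutes_not_in)
    also have "\<dots> = (\<Prod>i\<in>S. M i (p i))"
      using p by (intro prod.cong) (auto simp: permutes_in_image)
    finally show "(\<Prod>i\<in>UNIV. ?B $ i $ p i) = (\<Prod>i\<in>S. M i (p i))" .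
  qed
  finally show ?thesis ..
qed

text \<open>Otherwise let \<open>S\<close> be the support of \<open>a\<close>. Raising the diagonal
  on \<open>S\<close> can make the combination vanish in every column of \<open>S\<close>, and it
  preserves the P-property. The submatrix on \<open>S\<close> then has \<open>a\<close> in its left
  kernel, although its determinant is positive.\<close>

lemma P_matrix_no_nonpos_combination:
  fixes M :: "'p::finite \<Rightarrow> 'p \<Rightarrow> real"
  assumes P: "P_matrix M" and a: "\<And>i. 0 \<le> a i" and le: "\<And>j. (\<Sum>i\<in>UNIV. a i * M i j) \<le> 0"
  shows "a j = 0"
proof (rule ccontr)
  assume "a j \<noteq> 0"
  define S where "S = {i. a i \<noteq> 0}"
  \<comment> \<open>The entry that cancels column \<open>j\<close> exactly: adding it at position
    (j, j) contributes \<open>a j * c j\<close> to the combination. It is nonnegative because the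
    column sum is nonpositive.\<close>
  define c where "c j = (if j \<in> S then - (\<Sum>i\<in>UNIV. a i * M i j) / a j else 0)" for j
  define N where "N k l = M k l + (if k = l then c k else 0)" for k l
  have S: "S \<noteq> {}"
    using \<open>a j \<noteq> 0\<close> by (auto simp: S_def)
  have "0 \<le> c i" for i
    unfolding c_def using a[of i] le[of i] by (auto intro: divide_nonpos_nonneg)
  then have "P_matrix N"
    unfolding N_def by (intro P_matrix_add_diagonal[OF P])
  then have pos: "0 < pminor N S"
    using S by (simp add: P_matrix_def)
  let ?B = "\<chi> i j. if i \<in> S \<and> j \<in> S then N i j else if i = j then 1 else 0"
  have "transpose ?B *v (\<chi> i. a i) = 0"
  proof (clarsimp simp: vec_eq_iff matrix_vector_mult_def transpose_def)
    fix l
    show "(\<Sum>i\<in>UNIV. (if i \<in> S \<and> l \<in> S then N i l else if i = l then 1 else 0) * a i) = 0"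
    proof (cases "l \<in> S")
      case True
      have "(\<Sum>i\<in>UNIV. (if i \<in> S \<and> l \<in> S then N i l else if i = l then 1 else 0) * a i)
          = (\<Sum>i\<in>UNIV. a i * M i l + (if i = l then a l * c l else 0))"
        using True by (intro sum.cong) (auto simp: S_def N_def algebra_simps)
      also have "\<dots> = 0"
        using True by (simp add: sum.distrib c_def S_def)
      finally show ?thesis .
    next
      case False
      then show ?thesis
        by (intro sum.neutral) (auto simp: S_def)
    qed
  qed
  moreover have "(\<chi> i. a i) \<noteq> 0"
    using \<open>a j \<noteq> 0\<close> by (auto simp: vec_eq_iff)
  ultimately have "\<not> invertible (transpose ?B)"
    unfolding invertible_left_inverse matrix_left_invertible_ker by blast
  then have "det (transpose ?B) = 0"
    using invertible_det_nz by blast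
  then have "det ?B = 0"
    by (simp only: det_transpose)
  then show False
    using pos by (simp add: pminor_eq_det)
qed

text \<open>The alternative to a strictly positive image is, by separation of the cone spanned by the
  columns from the open positive orthant, a nonnegative row combination that is nonpositive.\<close>

lemma P_matrix_semipositive:
  fixes M :: "'p::finite \<Rightarrow> 'p \<Rightarrow> real"
  assumes P: "P_matrix M"
  obtains d where "\<And>i. 0 \<le> d i" and "\<And>i. 0 < (\<Sum>j\<in>UNIV. M i j * d j)"
proof -
  define A :: "real^'p^'p" where "A = (\<chi> i j. M i j)"
  define K where "K = (\<lambda>v. A *v v) ` {v. \<forall>i. 0 \<le> v $ i}"
  define O' :: "(real^'p) set" where "O' = {v. \<forall>i. 0 < v $ i}"
  have "K \<inter> O' \<noteq> {}"
  proof
    assume disj: "K \<inter> O' = {}"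
    have cK: "convex K"
      unfolding K_def
      by (intro convex_linear_image matrix_vector_mul_linear) (auto simp: convex_def)
    have cO: "convex O'"
      unfolding convex_alt O'_def
    proof (clarsimp)
      fix x y :: "real^'p" and u i
      assume "\<forall>i. 0 < x $ i" "\<forall>i. 0 < y $ i" and u: "0 \<le> u" "u \<le> (1::real)"
      then have "0 < x $ i" "0 < y $ i" by auto
      then show "0 < (1 - u) * x $ i + u * y $ i"
        using u by (cases "u = 1") (auto intro!: add_pos_nonneg)
    qed
    have ne: "K \<noteq> {}" "O' \<noteq> {}"
      by (auto simp: K_def O'_def intro: exI[of _ "\<chi> i. 1"] exI[of _ 0])
    obtain a b where a: "a \<noteq> 0" and aK: "\<And>x. x \<in> K \<Longrightarrow> a \<bullet> x \<le> b" and aO: "\<And>x. x \<in> O' \<Longrightarrow> b \<le> a \<bullet> x"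
      using separating_hyperplane_sets[OF cK cO ne disj] by auto
    have "0 \<in> K"
      unfolding K_def by (auto intro!: image_eqI[of _ _ 0])
    then have b: "0 \<le> b"
      using aK by fastforce
    \<comment> \<open>A linear quantity that stays bounded above along a ray has nonpositive slope.
      This is used for the directions of the orthant, giving \<open>0 \<le> a\<close>, and for the
      columns of \<open>M\<close>, giving the nonpositive combination.\<close>
    have scale: "y \<le> 0" if "\<And>t. 0 < t \<Longrightarrow> t * y \<le> c" for y c :: real
    proof (rule ccontr)
      assume "\<not> y \<le> 0"
      then have "((\<bar>c\<bar> + 1) / y) * y \<le> c"
        by (intro that) auto
      then show False using \<open>\<not> y \<le> 0\<close> by auto
    qed
    have nonneg: "0 \<le> a $ i" for i
    proof -
      have "t * (- a $ i) \<le> (\<Sum>k\<in>UNIV. a $ k)" if "0 < t" for t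
      proof -
        \<comment> \<open>Axis vectors lie only on the boundary of the open orthant; adding the
          all-ones vector moves the ray inside.\<close>
        have "(\<chi> k. 1) + t *\<^sub>R axis i 1 \<in> O'"
          using that by (auto simp: O'_def axis_def)
        from aO[OF this] b show ?thesis
          by (simp add: inner_add_right inner_axis) (simp add: inner_vec_def)
      qed
      from scale[OF this] show ?thesis by simp
    qed
    have "(\<Sum>i\<in>UNIV. a $ i * M i j) \<le> 0" for j
    proof (rule scale)
      fix t :: real assume "0 < t"
      then have "A *v (t *\<^sub>R axis j 1) \<in> K"
        by (auto simp: K_def axis_def)
      from aK[OF this] show "t * (\<Sum>i\<in>UNIV. a $ i * M i j) \<le> b"
        by (simp add: matrix_vector_mult_scaleR matrix_vector_mult_basis column_def inner_vec_def A_def sum_distrib_left mult_ac)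
    qed
    then have "a $ j = 0" for j
      using P_matrix_no_nonpos_combination[OF P, of "\<lambda>i. a $ i"] nonneg by blast
    then show False
      using a by (simp add: vec_eq_iff)
  qed
  then obtain v where v: "\<And>i. 0 \<le> v $ i" "\<And>i. 0 < (A *v v) $ i"
    by (auto simp: K_def O'_def)
  show thesis
    by (rule that[of "\<lambda>i. v $ i"]) (use v in \<open>auto simp: A_def matrix_vector_mult_def\<close>)
qed

lemma P_matrix_diagonal_pos:
  assumes "P_matrix M"
  shows "0 < M i i"
proof -
  have "{p. p permutes {i}} = {id}"
    by auto
  then have "pminor M {i} = M i i"
    by (simp add: pminor_def)
  then show ?thesis
    using assms by (metis P_matrix_def insert_not_empty)
qed

text \<open>For a Z-matrix, the positive vector \<open>d\<close> provides the weights of a maximum norm in which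
  best responses contract.\<close>

lemma P_matrix_Z_matrix_contraction:
  fixes M :: "'p::finite \<Rightarrow> 'p \<Rightarrow> real"
  assumes P: "P_matrix M" and Z: "\<And>i j. i \<noteq> j \<Longrightarrow> M i j \<le> 0"
  obtains d \<rho> where "\<And>i. 0 < d i" and "0 \<le> \<rho>" and "\<rho> < 1"
    and "\<And>i w B. \<lbrakk>\<And>j. 0 \<le> w j; w i * (\<Sum>j\<in>UNIV. M i j * w j) \<le> 0; 0 \<le> B;
           \<And>j. j \<noteq> i \<Longrightarrow> w j \<le> B * d j\<rbrakk> \<Longrightarrow> w i \<le> \<rho> * B * d i"
proof -
  obtain d where d0: "\<And>i. 0 \<le> d i" and Md: "\<And>i. 0 < (\<Sum>j\<in>UNIV. M i j * d j)"
    using P_matrix_semipositive[OF P] by blast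
  have split: "(\<Sum>j\<in>UNIV. M i j * w j) = M i i * w i + (\<Sum>j\<in>UNIV - {i}. M i j * w j)" for i w
    by (intro sum.remove) auto
  have off: "(\<Sum>j\<in>UNIV - {i}. M i j * w j) \<le> 0" if "\<And>j. 0 \<le> w j" for i w
    using Z that by (intro sum_nonpos) (auto intro: mult_nonpos_nonneg)
  have diag: "0 < M i i" for i
    by (rule P_matrix_diagonal_pos[OF P])
  \<comment> \<open>With nonpositive off-diagonal terms, a positive row value can only come from
    \<open>M i i * d i\<close>, so \<open>d\<close> is strictly positive.\<close>
  have d: "0 < d i" for i
  proof -
    have "0 < M i i * d i"
      using Md[of i] off[of d i, OF d0] split[of i d] by linarith
    then show ?thesis
      using diag[of i] by (simp add: zero_less_mult_iff)
  qed
  \<comment> \<open>The off-diagonal part of row \<open>i\<close>, weighted by \<open>d\<close>,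
    relative to its diagonal term. Positivity of row \<open>i\<close> of M d says precisely that
    this ratio is below 1.\<close>
  define r where "r i = - (\<Sum>j\<in>UNIV - {i}. M i j * d j) / (M i i * d i)" for i
  have r0: "0 \<le> r i" for i
    unfolding r_def using off[of d i, OF d0] d[of i] diag[of i] by (intro divide_nonneg_pos) auto
  have r1: "r i < 1" for i
    unfolding r_def using Md[of i] split[of i d] d[of i] diag[of i]
    by (subst pos_divide_less_eq) auto
  define \<rho> where "\<rho> = Max (range r)"
  have r_le: "r i \<le> \<rho>" for i
    unfolding \<rho>_def by simp
  have rho: "0 \<le> \<rho>" "\<rho> < 1"
  proof -
    show "0 \<le> \<rho>"
      by (rule order_trans[OF r0[of undefined] r_le])
    show "\<rho> < 1"
      using r1 by (simp add: \<rho>_def)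
  qed
  show thesis
  proof (rule that[of d \<rho>, OF d rho])
    fix i w and B :: real
    assume w: "\<And>j. 0 \<le> w j" and le: "w i * (\<Sum>j\<in>UNIV. M i j * w j) \<le> 0" and B: "0 \<le> B"
      and wB: "\<And>j. j \<noteq> i \<Longrightarrow> w j \<le> B * d j"
    show "w i \<le> \<rho> * B * d i"
    proof (cases "w i = 0")
      case True
      then show ?thesis using rho B d0 by simp
    next
      case False
      then have "0 < w i" using w[of i] by simp
      then have "(\<Sum>j\<in>UNIV. M i j * w j) \<le> 0"
        using le by (simp add: mult_le_0_iff)
      then have "M i i * w i \<le> - (\<Sum>j\<in>UNIV - {i}. M i j * w j)"
        using split[of i w] by simp
      also have "\<dots> \<le> - (\<Sum>j\<in>UNIV - {i}. M i j * (B * d j))"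
        using Z wB by (auto intro!: sum_mono mult_left_mono_neg)
      also have "\<dots> = B * - (\<Sum>j\<in>UNIV - {i}. M i j * d j)"
        by (simp add: sum_distrib_left mult.left_commute)
      also have "\<dots> = B * (r i * (M i i * d i))"
        using d[of i] diag[of i] by (simp add: r_def)
      also have "\<dots> \<le> B * (\<rho> * (M i i * d i))"
        using B r_le[of i] d0[of i] diag[of i] by (intro mult_left_mono mult_right_mono) auto
      finally have "M i i * w i \<le> M i i * (\<rho> * B * d i)"
        by (simp add: mult_ac)
      then show ?thesis
        using diag[of i] by simp
    qed
  qed
qed

section \<open>Block structure and least eigenvalues\<close>

lemma proj_nth [simp]: "proj blk i x $ k = (if blk k = i then x $ k else 0)"
  by (simp add: proj_def)

lemma linear_proj: "linear (proj blk i)"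
  by (intro linearI) (auto simp: vec_eq_iff)

lemmas proj_add = linear_add[OF linear_proj]
lemmas proj_diff = linear_diff[OF linear_proj]
lemmas proj_scaleR = linear_scale[OF linear_proj]
lemmas proj_0 [simp] = linear_0[OF linear_proj]

lemma proj_proj: "proj blk i (proj blk j x) = (if i = j then proj blk i x else 0)"
  by (auto simp: vec_eq_iff)

lemma proj_in_blocksp [simp]: "proj blk i x \<in> blocksp blk i"
  by (simp add: blocksp_def)

lemma proj_eq_iff: "proj blk i x = x \<longleftrightarrow> x \<in> blocksp blk i"
  by (auto simp: blocksp_def vec_eq_iff)

lemma proj_blocksp_other: "x \<in> blocksp blk i \<Longrightarrow> i \<noteq> j \<Longrightarrow> proj blk j x = 0"
  by (metis proj_eq_iff proj_proj)

lemma sum_proj: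
  fixes blk :: "'k::finite \<Rightarrow> 'p::finite"
  shows "(\<Sum>i\<in>UNIV. proj blk i x) = x"
  by (simp add: vec_eq_iff)

lemma sum_proj_others:
  fixes blk :: "'k::finite \<Rightarrow> 'p::finite"
  shows "(\<Sum>j\<in>UNIV - {i}. proj blk j x) = x - proj blk i x"
  using sum.remove[of UNIV i "\<lambda>j. proj blk j x"] by (simp add: sum_proj algebra_simps)

lemma proj_sum_proj:
  fixes blk :: "'k::finite \<Rightarrow> 'p::finite"
  assumes "finite J"
  shows "proj blk i (\<Sum>j\<in>J. proj blk j (x j)) = (if i \<in> J then proj blk i (x i) else 0)"
proof -
  have "proj blk i (\<Sum>j\<in>J. proj blk j (x j)) = (\<Sum>j\<in>J. if i = j then proj blk i (x j) else 0)"
    by (simp add: linear_sum[OF linear_proj] proj_proj)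
  also have "\<dots> = (if i \<in> J then proj blk i (x i) else 0)"
    using assms by (simp add: sum.delta')
  finally show ?thesis .
qed

lemma inner_proj_left: "proj blk i x \<bullet> y = x \<bullet> proj blk i y"
  unfolding inner_vec_def by (intro sum.cong) auto

lemma subspace_blocksp: "subspace (blocksp blk i)"
  by (auto simp: subspace_def blocksp_def)

lemma blockM_mult_vec: "blockM blk i j M *v v = proj blk i (M *v proj blk j v)"
  by (auto simp: vec_eq_iff blockM_def matrix_vector_mult_def intro!: sum.cong)

lemma transpose_blockM: "transpose (blockM blk i j M) = blockM blk j i (transpose M)"
  by (auto simp: vec_eq_iff blockM_def transpose_def)

text \<open>Eigenvectors for distinct eigenvalues of a symmetric matrix are orthogonal, hence
  independent, so there are finitely many. This gives the \<open>Min\<close> in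
  \<open>lambda_least\<close> its meaning.\<close>

lemma finite_eigenvalues_symmetric:
  fixes B :: "real^'k^'k"
  assumes "transpose B = B"
  shows "finite {l. \<exists>v \<in> V. v \<noteq> 0 \<and> B *v v = l *\<^sub>R v}" (is "finite ?S")
proof -
  define e where "e l = (SOME v. v \<noteq> 0 \<and> B *v v = l *\<^sub>R v)" for l
  have e: "e l \<noteq> 0" "B *v e l = l *\<^sub>R e l" if "l \<in> ?S" for l
    using someI_ex[of "\<lambda>v. v \<noteq> 0 \<and> B *v v = l *\<^sub>R v"] that unfolding e_def by auto
  have orth: "e l \<bullet> e m = 0" if "l \<in> ?S" "m \<in> ?S" "l \<noteq> m" for l m
  proof -
    have "l * (e l \<bullet> e m) = (B *v e l) \<bullet> e m"
      using e that by simp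
    also have "\<dots> = e l \<bullet> (B *v e m)"
      by (metis assms dot_lmul_matrix vector_transpose_matrix)
    also have "\<dots> = m * (e l \<bullet> e m)"
      using e that by simp
    finally show ?thesis
      using that by simp
  qed
  have "pairwise orthogonal (e ` ?S)"
    unfolding pairwise_def orthogonal_def using orth by auto
  moreover have "0 \<notin> e ` ?S"
  proof
    assume "0 \<in> e ` ?S"
    then obtain l where "0 = e l" and l: "l \<in> ?S"
      by (rule imageE)
    then show False using e(1)[OF l] by simp
  qed
  ultimately have "finite (e ` ?S)"
    by (intro independent_imp_finite pairwise_orthogonal_independent)
  moreover have "inj_on e ?S"
  proof (rule inj_onI, rule ccontr)
    fix l m assume lm: "l \<in> ?S" "m \<in> ?S" "e l = e m" "l \<noteq> m"
    then have "e l \<bullet> e l = 0" using orth[OF lm(1,2,4)] by simp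
    then show False using e(1)[OF lm(1)] by simp
  qed
  ultimately show ?thesis
    by (rule finite_imageD)
qed

text \<open>A minimizer \<open>v\<close> of the Rayleigh quotient over the unit sphere of
  \<open>V\<close> is an eigenvector: the residual \<open>r = B *v v - m *\<^sub>R v\<close> stays
  in \<open>V\<close> by invariance, and moving \<open>v\<close> along \<open>-r\<close> would lower
  the quotient unless \<open>r\<close> is zero.\<close>

lemma symmetric_min_eigenvector:
  fixes B :: "real^'k^'k"
  assumes sym: "transpose B = B" and V: "subspace V" and BV: "\<And>v. v \<in> V \<Longrightarrow> B *v v \<in> V"
    and ne: "\<exists>v\<in>V. v \<noteq> 0"
  obtains m v where "v \<in> V" "v \<noteq> 0" "B *v v = m *\<^sub>R v"
    and "\<And>u. u \<in> V \<Longrightarrow> m * (u \<bullet> u) \<le> u \<bullet> (B *v u)"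
proof -
  define S where "S = V \<inter> sphere 0 1"
  have "compact S"
    unfolding S_def using closed_subspace[OF V] by (simp add: closed_Int_compact)
  obtain w where "w \<in> V" "w \<noteq> 0"
    using ne by blast
  then have "(1 / norm w) *\<^sub>R w \<in> S"
    using V by (simp add: S_def subspace_scale)
  then have "S \<noteq> {}" by blast
  have "continuous_on S (\<lambda>u. u \<bullet> (B *v u))"
    by (intro continuous_intros linear_continuous_on matrix_vector_mul_bounded_linear)
  then obtain v where v: "v \<in> S" and vmin: "\<And>u. u \<in> S \<Longrightarrow> v \<bullet> (B *v v) \<le> u \<bullet> (B *v u)"
    using continuous_attains_inf[OF \<open>compact S\<close> \<open>S \<noteq> {}\<close>] by blast
  define m where "m = v \<bullet> (B *v v)"
  have vV: "v \<in> V" and vv: "v \<bullet> v = 1" and v0: "v \<noteq> 0"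
    using v by (auto simp: S_def norm_eq_1)
  have ray: "m * (u \<bullet> u) \<le> u \<bullet> (B *v u)" if u: "u \<in> V" for u
  proof (cases "u = 0")
    case False
    have "(1 / norm u) *\<^sub>R u \<in> S"
      using False V u by (simp add: S_def subspace_scale)
    from vmin[OF this] have "m \<le> (u \<bullet> (B *v u)) / (norm u)\<^sup>2"
      by (simp add: m_def matrix_vector_mult_scaleR power2_eq_square)
    then show ?thesis
      using False by (simp add: pos_le_divide_eq power2_norm_eq_inner)
  qed simp
  define r where "r = B *v v - m *\<^sub>R v"
  have rV: "r \<in> V"
    unfolding r_def using V vV BV by (simp add: subspace_diff subspace_scale)
  have swap: "v \<bullet> (B *v r) = r \<bullet> (B *v v)"
    by (metis sym dot_lmul_matrix vector_transpose_matrix inner_commute)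
  define q where "q = r \<bullet> (B *v r) - m * (r \<bullet> r)"
  \<comment> \<open>The minimality of \<open>m\<close> at \<open>v + t *\<^sub>R r\<close>, expanded
    in \<open>t\<close>. The linear coefficient is twice \<open>r \<bullet> r\<close>, so a small
    negative \<open>t\<close> forces \<open>r\<close> to vanish.\<close>
  have quad: "0 \<le> 2 * t * (r \<bullet> r) + t\<^sup>2 * q" for t
  proof -
    have "v + t *\<^sub>R r \<in> V"
      using V vV rV by (simp add: subspace_add subspace_scale)
    from ray[OF this] have "0 \<le> (v + t *\<^sub>R r) \<bullet> (B *v (v + t *\<^sub>R r)) - m * ((v + t *\<^sub>R r) \<bullet> (v + t *\<^sub>R r))"
      by simp
    also have "\<dots> = 2 * t * (r \<bullet> (B *v v) - m * (r \<bullet> v)) + t\<^sup>2 * q"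
      using swap vv by (simp add: matrix_vector_right_distrib matrix_vector_mult_scaleR inner_add_left
          inner_add_right m_def[symmetric] q_def power2_eq_square inner_commute algebra_simps)
    also have "r \<bullet> (B *v v) - m * (r \<bullet> v) = r \<bullet> r"
      by (simp add: r_def inner_diff_right)
    finally show ?thesis .
  qed
  have "r \<bullet> r = 0"
  proof (rule ccontr)
    assume "r \<bullet> r \<noteq> 0"
    then have b: "0 < r \<bullet> r" by simp
    \<comment> \<open>Small enough that the quadratic term at \<open>t = - s\<close> is at most
      \<open>s * (r \<bullet> r)\<close>, half of what the linear term removes; the added 1 avoids
      division by zero.\<close>
    define s where "s = (r \<bullet> r) / (\<bar>q\<bar> + 1)"
    have s: "0 < s" "s * (\<bar>q\<bar> + 1) = r \<bullet> r"
      using b by (auto simp: s_def)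
    have "s * q \<le> s * (\<bar>q\<bar> + 1)"
      using s by (intro mult_left_mono) auto
    then have "s * (s * q) \<le> s * (r \<bullet> r)"
      using s by (intro mult_left_mono) auto
    moreover have "0 < s * (r \<bullet> r)"
      using s b by simp
    moreover have "0 \<le> s * (s * q) - 2 * (s * (r \<bullet> r))"
      using quad[of "- s"] by (simp add: power2_eq_square)
    ultimately show False by linarith
  qed
  then have "B *v v = m *\<^sub>R v"
    by (simp add: r_def)
  then show thesis
    using that vV v0 ray by blast
qed

text \<open>The skew part of \<open>A\<close> does not contribute to the quadratic form, so the
  Rayleigh bound for the symmetric part carries over. The second bound serves to show that the
  infimum on the diagonal of \<Upsilon> is over a set bounded below. Surjectivity of
  \<open>blk\<close> makes the block nonzero, so that an eigenvalue exists.\<close>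

lemma lambda_least_bounds:
  fixes blk :: "'k::finite \<Rightarrow> 'p" and A :: "real^'k^'k"
  assumes "surj blk" and A: "blockM blk i i A = A"
  shows "u \<in> blocksp blk i \<Longrightarrow> lambda_least blk i A * (norm u)\<^sup>2 \<le> u \<bullet> (A *v u)"
    and "- norm2 A \<le> lambda_least blk i A"
proof -
  define B where "B = (1/2) *\<^sub>R (A + transpose A)"
  define S where "S = {l. \<exists>v \<in> blocksp blk i. v \<noteq> 0 \<and> B *v v = l *\<^sub>R v}"
  have ll: "lambda_least blk i A = Min S"
    by (simp add: lambda_least_def S_def B_def)
  have sym: "transpose B = B"
    by (simp add: B_def vec_eq_iff transpose_def)
  have fin: "finite S"
    unfolding S_def by (rule finite_eigenvalues_symmetric[OF sym])
  have Bv: "B *v v = (1/2) *\<^sub>R (A *v v + transpose A *v v)" for v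
    by (simp add: B_def scaleR_matrix_vector_assoc[symmetric] matrix_vector_mult_add_rdistrib)
  have AV: "A *v v \<in> blocksp blk i" "transpose A *v v \<in> blocksp blk i" for v
    using blockM_mult_vec[of blk i i A v] blockM_mult_vec[of blk i i "transpose A" v] A
      transpose_blockM[of blk i i A] by (metis proj_in_blocksp)+
  have BV: "B *v v \<in> blocksp blk i" for v
    unfolding Bv using AV subspace_blocksp by (intro subspace_scale subspace_add) auto
  have BA: "u \<bullet> (B *v u) = u \<bullet> (A *v u)" for u
  proof -
    have "u \<bullet> (transpose A *v u) = u \<bullet> (A *v u)"
      by (metis dot_lmul_matrix vector_transpose_matrix inner_commute transpose_transpose)
    then show ?thesis
      by (simp add: Bv inner_add_right)
  qed
  obtain k where "blk k = i"
    using \<open>surj blk\<close> by (metis surjD)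
  then have "axis k (1::real) \<in> blocksp blk i"
    by (auto simp: blocksp_def axis_def)
  moreover have "axis k (1::real) \<noteq> 0"
    by (simp add: axis_eq_0_iff)
  ultimately have ne: "\<exists>v\<in>blocksp blk i. v \<noteq> 0"
    by blast
  obtain m v where m: "v \<in> blocksp blk i" "v \<noteq> 0" "B *v v = m *\<^sub>R v"
    and ray: "\<And>u. u \<in> blocksp blk i \<Longrightarrow> m * (u \<bullet> u) \<le> u \<bullet> (B *v u)"
    using symmetric_min_eigenvector[OF sym subspace_blocksp BV ne] by blast
  have mS: "m \<in> S"
    using m by (auto simp: S_def)
  show "lambda_least blk i A * (norm u)\<^sup>2 \<le> u \<bullet> (A *v u)" if "u \<in> blocksp blk i"
  proof -
    have "Min S * (norm u)\<^sup>2 \<le> m * (norm u)\<^sup>2"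
      using fin mS by (intro mult_right_mono) auto
    then show ?thesis
      using ray[OF that] by (simp add: ll BA power2_norm_eq_inner)
  qed
  have "Min S \<in> S"
    using fin mS by (intro Min_in) auto
  then obtain w where w: "w \<noteq> 0" "B *v w = Min S *\<^sub>R w"
    by (auto simp: S_def)
  have "- (norm2 A * (norm w)\<^sup>2) \<le> w \<bullet> (A *v w)"
  proof -
    have "- (w \<bullet> (A *v w)) \<le> norm w * norm (A *v w)"
      using Cauchy_Schwarz_ineq2[of w "A *v w"] by simp
    also have "\<dots> \<le> norm w * (norm2 A * norm w)"
      unfolding norm2_def by (intro mult_left_mono onorm matrix_vector_mul_bounded_linear) auto
    finally show ?thesis
      by (simp add: power2_eq_square mult_ac)
  qed
  also have "w \<bullet> (A *v w) = Min S * (norm w)\<^sup>2"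
    using w BA[of w] by (simp add: power2_norm_eq_inner)
  finally have "- norm2 A * (norm w)\<^sup>2 \<le> Min S * (norm w)\<^sup>2"
    by simp
  then show "- norm2 A \<le> lambda_least blk i A"
    using w unfolding ll by (metis mult_right_le_imp_le zero_less_norm_iff zero_less_power)
qed

section \<open>Asynchronous contractions\<close>

text \<open>Suppose all entries are below \<open>\<rho> ^ k * K\<close> from some time on. By A2 a
  player eventually sees only data from this box, and by A3 it updates again; from then on its entry
  is below \<open>\<rho> ^ Suc k * K\<close>. Induction on \<open>k\<close> yields boxes shrinking
  to 0.\<close>

lemma async_contraction_tendsto_0:
  fixes u :: "'p::finite \<Rightarrow> nat \<Rightarrow> real"
  assumes sched: "schedule_ok T tau" and rho: "0 \<le> \<rho>" "\<rho> < 1" and u0: "\<And>i n. 0 \<le> u i n"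
    and upd: "\<And>i n B. \<lbrakk>n \<in> T i; 0 \<le> B; \<And>j. j \<noteq> i \<Longrightarrow> u j (tau i j n) \<le> B\<rbrakk> \<Longrightarrow> u i (Suc n) \<le> \<rho> * B"
    and keep: "\<And>i n. n \<notin> T i \<Longrightarrow> u i (Suc n) = u i n"
  shows "u i \<longlonglongrightarrow> 0"
proof -
  have A1: "tau i j n \<le> n" if "j \<noteq> i" for i j n
    using sched that by (simp add: schedule_ok_def)
  have A3: "infinite (T i)" for i
    using sched by (simp add: schedule_ok_def)
  \<comment> \<open>The sequential form of A2 is turned into a threshold. Without one, infinitely
    many update times would use information older than \<open>N\<close>, and enumerating them would
    contradict A2.\<close>
  have A2: "\<exists>n0. \<forall>n\<in>T i. n0 \<le> n \<longrightarrow> N \<le> tau i j n" if ij: "j \<noteq> i" for i j N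
  proof (rule ccontr)
    assume "\<not> ?thesis"
    then have inf: "infinite {n \<in> T i. tau i j n < N}"
      unfolding infinite_nat_iff_unbounded_le by (auto simp: not_le)
    define nk where "nk = enumerate {n \<in> T i. tau i j n < N}"
    have nk: "nk k \<in> T i" "tau i j (nk k) < N" for k
      using enumerate_in_set[OF inf, of k] by (auto simp: nk_def)
    have "filterlim nk at_top sequentially"
      unfolding nk_def by (intro filterlim_subseq strict_mono_enumerate inf)
    then have "filterlim (\<lambda>k. tau i j (nk k)) at_top sequentially"
      using sched ij nk by (simp add: schedule_ok_def)
    then have "\<forall>\<^sub>F k in sequentially. N \<le> tau i j (nk k)"
      by (simp add: filterlim_at_top)
    then show False
      using nk by (auto simp: eventually_sequentially not_le[symmetric])
  qed
  define K where "K = Max (range (\<lambda>i. u i 0))"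
  have uK0: "u i 0 \<le> K" for i
    by (simp add: K_def)
  have K0: "0 \<le> K"
    using uK0 u0 order_trans by blast
  have uK: "\<forall>i. u i n \<le> K" for n
  proof (induction n rule: less_induct)
    case (less n)
    show ?case
    proof (cases n)
      case 0
      then show ?thesis using uK0 by simp
    next
      case (Suc m)
      show ?thesis
      proof
        fix i
        show "u i n \<le> K"
        proof (cases "m \<in> T i")
          case True
          \<comment> \<open>By A1 all information used at time \<open>m\<close> is at most
            \<open>m\<close> old in index, so the strong induction hypothesis covers it.\<close>
          have "u i (Suc m) \<le> \<rho> * K"
            using less A1[of _ i m] Suc by (intro upd True K0) (auto simp: less_Suc_eq_le)
          also have "\<dots> \<le> K"
            using rho K0 by (simp add: mult_left_le_one_le)
          finally show ?thesis using Suc by simp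
        next
          case False
          then show ?thesis using less Suc keep by simp
        qed
      qed
    qed
  qed
  have box: "\<exists>N. \<forall>n\<ge>N. \<forall>i. u i n \<le> \<rho> ^ k * K" for k
  proof (induction k)
    case 0
    then show ?case using uK by simp
  next
    case (Suc k)
    then obtain N where N: "\<And>n i. N \<le> n \<Longrightarrow> u i n \<le> \<rho> ^ k * K"
      by blast
    have "\<exists>N'. \<forall>n\<ge>N'. u i n \<le> \<rho> ^ Suc k * K" for i
    proof -
      obtain n0 where n0: "\<And>j n. j \<noteq> i \<Longrightarrow> n \<in> T i \<Longrightarrow> n0 j \<le> n \<Longrightarrow> N \<le> tau i j n"
        using A2[of _ i N] by metis
      \<comment> \<open>From \<open>n1\<close> on, every update of player \<open>i\<close> relies
        only on values of the others that already lie in box \<open>k\<close>.\<close>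
      define n1 where "n1 = Max (range n0)"
      have n1: "n0 j \<le> n1" for j
        by (simp add: n1_def)
      have step: "u i (Suc n) \<le> \<rho> ^ Suc k * K" if "n \<in> T i" "n1 \<le> n" for n
      proof -
        have "u i (Suc n) \<le> \<rho> * (\<rho> ^ k * K)"
          using that rho K0 n0 n1 order_trans by (intro upd N) (simp_all, blast)
        then show ?thesis by (simp add: mult_ac)
      qed
      \<comment> \<open>The smaller bound can be claimed only after an actual update past
        \<open>n1\<close>, hence from \<open>Suc n2\<close> on; between updates the value is
        kept.\<close>
      obtain n2 where n2: "n2 \<in> T i" "n1 \<le> n2"
        using A3[of i] by (meson infinite_nat_iff_unbounded_le)
      have "u i n \<le> \<rho> ^ Suc k * K" if "Suc n2 \<le> n" for n
        using that
      proof (induction n rule: dec_induct)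
        case base
        show ?case using step n2 by simp
      next
        case (step n)
        then show ?case
          using \<open>\<And>n. n \<in> T i \<Longrightarrow> n1 \<le> n \<Longrightarrow> u i (Suc n) \<le> \<rho> ^ Suc k * K\<close>[of n] keep[of n i] n2
          by (cases "n \<in> T i") auto
      qed
      then show ?thesis by blast
    qed
    then obtain N' where N': "\<And>i n. N' i \<le> n \<Longrightarrow> u i n \<le> \<rho> ^ Suc k * K"
      by metis
    have "u i n \<le> \<rho> ^ Suc k * K" if "Max (range N') \<le> n" for n i
      by (rule N') (use that in simp)
    then show ?case by blast
  qed
  show ?thesis
  proof (rule LIMSEQ_I)
    fix e :: real assume "0 < e"
    have "(\<lambda>k. \<rho> ^ k * K) \<longlonglongrightarrow> 0 * K"
      using rho by (intro tendsto_intros LIMSEQ_realpow_zero) auto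
    then have "\<forall>\<^sub>F k in sequentially. \<rho> ^ k * K < e"
      using \<open>0 < e\<close> by (intro order_tendstoD) auto
    then obtain k where "\<rho> ^ k * K < e"
      by (auto simp: eventually_sequentially)
    then show "\<exists>N. \<forall>n\<ge>N. norm (u i n - 0) < e"
      using box[of k] u0 by (metis abs_of_nonneg diff_zero le_less_trans real_norm_def)
  qed
qed

section \<open>Best responses\<close>

lemma minimum_first_order:
  fixes f :: "'a::real_inner \<Rightarrow> real"
  assumes f: "(f has_derivative (\<lambda>h. g \<bullet> h)) (at x)"
    and le: "\<And>t. 0 \<le> t \<Longrightarrow> t \<le> 1 \<Longrightarrow> f x \<le> f (x + t *\<^sub>R h)"
  shows "0 \<le> g \<bullet> h"
proof (rule ccontr)
  assume neg: "\<not> 0 \<le> g \<bullet> h"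
  have "((\<lambda>t. f (x + t *\<^sub>R h)) has_derivative (\<lambda>s. g \<bullet> (s *\<^sub>R h))) (at 0)"
    by (rule has_derivative_compose[where f="\<lambda>t. x + t *\<^sub>R h" and g=f, unfolded o_def])
       (use f in \<open>auto intro!: derivative_eq_intros\<close>)
  then have "((\<lambda>t. f (x + t *\<^sub>R h)) has_real_derivative (g \<bullet> h)) (at 0)"
    by (simp add: has_field_derivative_def mult.commute[of _ "g \<bullet> h"])
  from DERIV_neg_dec_right[OF this] neg obtain e where e: "0 < e"
    "\<And>t. 0 < t \<Longrightarrow> t < e \<Longrightarrow> f (x + t *\<^sub>R h) < f x"
    by auto
  define t where "t = min (e / 2) 1"
  have "0 < t" "t < e" "t \<le> 1"
    using e by (auto simp: t_def min_def)
  then show False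
    using e(2)[of t] le[of t] by simp
qed

lemma segment_mean_value:
  fixes f :: "'a::real_normed_vector \<Rightarrow> real"
  assumes "\<And>t. 0 \<le> t \<Longrightarrow> t \<le> 1 \<Longrightarrow> (f has_derivative f' (x + t *\<^sub>R h)) (at (x + t *\<^sub>R h))"
  obtains t where "0 < t" "t < 1" "f (x + h) - f x = f' (x + t *\<^sub>R h) h"
proof -
  have "((\<lambda>t. f (x + t *\<^sub>R h)) has_real_derivative f' (x + t *\<^sub>R h) h) (at t)"
    if "0 \<le> t" "t \<le> 1" for t
  proof -
    have "((\<lambda>t. f (x + t *\<^sub>R h)) has_derivative (\<lambda>s. f' (x + t *\<^sub>R h) (s *\<^sub>R h))) (at t)"
      by (rule has_derivative_compose[where f="\<lambda>t. x + t *\<^sub>R h" and g=f])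
         (use assms[OF that] in \<open>auto intro!: derivative_eq_intros\<close>)
    moreover have "linear (f' (x + t *\<^sub>R h))"
      using assms[OF that] has_derivative_linear by blast
    ultimately show ?thesis
      by (simp add: has_field_derivative_def linear_scale mult.commute[of _ "f' _ _"])
  qed
  from MVT2[of 0 1, OF _ this] show thesis
    using that by auto
qed

lemma norm2_mult_vec: "norm (A *v v) \<le> norm2 A * norm v"
  unfolding norm2_def by (intro onorm matrix_vector_mul_bounded_linear)

lemma norm2_nonneg: "0 \<le> norm2 A"
  unfolding norm2_def by (intro onorm_pos_le matrix_vector_mul_bounded_linear)

text \<open>Converts boundedness of the Hessians as elements of a normed space into boundedness of
  operator norms.\<close>

lemma norm2_le_norm:
  fixes A :: "real^'k^'k"
  shows "norm2 A \<le> real CARD('k) * real CARD('k) * norm A"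
  unfolding norm2_def
proof (rule onorm_le_matrix_component)
  fix i j
  have "\<bar>A $ i $ j\<bar> \<le> norm (A $ i)"
    by (rule component_le_norm_cart)
  also have "\<dots> \<le> norm A"
    by (rule Finite_Cartesian_Product.norm_nth_le)
  finally show "\<bar>A $ i $ j\<bar> \<le> norm A" .
qed

section \<open>The game and its strategy sets\<close>

locale P_Upsilon_NEP =
  fixes blk :: "'k::finite \<Rightarrow> 'p::finite"
    and Q :: "'p \<Rightarrow> (real^'k) set"
    and f :: "'p \<Rightarrow> real^'k \<Rightarrow> real"
    and grad :: "'p \<Rightarrow> real^'k \<Rightarrow> real^'k"
    and hess :: "'p \<Rightarrow> real^'k \<Rightarrow> real^'k^'k"
    and C :: "'p \<Rightarrow> real^'k^'k"
  assumes blocks_nonempty: "surj blk"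
    and Q_sub: "\<And>i. Q i \<subseteq> blocksp blk i"
    and Q_ne: "\<And>i. Q i \<noteq> {}"
    and Q_closed: "\<And>i. closed (Q i)"
    and Q_convex: "\<And>i. convex (Q i)"
    and grad: "\<And>i x. x \<in> prodQ blk Q \<Longrightarrow> (f i has_derivative (\<lambda>h. grad i x \<bullet> h)) (at x)"
    and hess: "\<And>i x. x \<in> prodQ blk Q \<Longrightarrow> (grad i has_derivative (\<lambda>h. hess i x *v h)) (at x)"
    and grad_bdd: "\<And>i. bounded (grad i ` prodQ blk Q)"
    and hess_bdd: "\<And>i. bounded (hess i ` prodQ blk Q)"
    and C_nonsing: "\<And>i. nonsing_block blk i (C i)"
    and P_mat: "P_matrix (Upsilon blk Q hess C)"
begin

abbreviation "QQ \<equiv> prodQ blk Q"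
abbreviation "\<Upsilon> \<equiv> Upsilon blk Q hess C"
abbreviation "\<pi> \<equiv> proj blk"

lemma proj_Q: "y \<in> Q i \<Longrightarrow> \<pi> i y = y"
  using Q_sub[of i] by (auto simp: proj_eq_iff)

text \<open>Describes the profile against which an updating player optimizes: its own block
  \<open>y\<close> together with blocks of the others taken from possibly different
  iterates.\<close>

lemma prodQ_combine:
  assumes "y \<in> Q i" and "\<And>j. j \<noteq> i \<Longrightarrow> \<pi> j (x j) \<in> Q j"
  defines "p \<equiv> y + (\<Sum>j\<in>UNIV - {i}. \<pi> j (x j))"
  shows "p \<in> QQ" and "\<pi> i p = y" and "j \<noteq> i \<Longrightarrow> \<pi> j p = \<pi> j (x j)"
proof -
  have p: "\<pi> j p = (if j = i then y else \<pi> j (x j))" for j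
    using assms(1) Q_sub proj_Q proj_blocksp_other[of y blk i j]
    by (auto simp: p_def proj_add proj_sum_proj)
  show "p \<in> QQ"
    using assms(1,2) p by (simp add: prodQ_def)
  show "\<pi> i p = y" and "j \<noteq> i \<Longrightarrow> \<pi> j p = \<pi> j (x j)"
    using p by auto
qed

lemma prodQ_replace:
  assumes "x \<in> QQ" "y \<in> Q i"
  shows "y + (x - \<pi> i x) \<in> QQ"
  using prodQ_combine(1)[OF assms(2), of "\<lambda>_. x"] assms(1)
  by (simp add: sum_proj_others prodQ_def)

lemma convex_prodQ: "convex QQ"
  unfolding convex_def prodQ_def
  using Q_convex by (auto simp: convex_def proj_add proj_scaleR)

lemma prodQ_segment:
  assumes "x \<in> QQ" "x + h \<in> QQ" "0 \<le> t" "t \<le> 1"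
  shows "x + t *\<^sub>R h \<in> QQ"
proof -
  have "(1 - t) *\<^sub>R x + t *\<^sub>R (x + h) \<in> QQ"
    using convex_prodQ assms by (simp add: convex_alt)
  then show ?thesis
    by (simp add: algebra_simps)
qed

lemma closed_prodQ: "closed QQ"
proof -
  have "QQ = (\<Inter>i. \<pi> i -` Q i)"
    by (auto simp: prodQ_def)
  moreover have "closed (\<pi> i -` Q i)" for i
    by (intro closed_vimage Q_closed linear_continuous_on linear_conv_bounded_linear[THEN iffD1]
        linear_proj)
  ultimately show ?thesis
    by auto
qed

lemma prodQ_nonempty: "QQ \<noteq> {}"
proof -
  define q where "q i = (SOME y. y \<in> Q i)" for i
  have q: "q i \<in> Q i" for i
    unfolding q_def using Q_ne[of i] by (simp add: some_in_eq)
  have "\<pi> j (q j) \<in> Q j" for j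
    using q proj_Q by simp
  then show ?thesis
    using prodQ_combine(1)[OF q, of undefined q] by blast
qed

section \<open>Block coordinates given by the matrices \<open>C i\<close>\<close>

lemma C_mult_vec: "C i *v v = \<pi> i (C i *v \<pi> i v)"
  using C_nonsing[of i] blockM_mult_vec[of blk i i "C i" v] by (simp add: nonsing_block_def)

text \<open>The sum of the \<open>C i\<close> acts as a block diagonal map that is injective on each
  block. Its inverse inverts all the \<open>C i\<close> at once, as a single linear map.\<close>

lemma ex_block_inverse: "\<exists>D. linear D \<and> (\<forall>v i. \<pi> i v = C i *v \<pi> i (D v))"
proof -
  define L where "L v = (\<Sum>i\<in>UNIV. C i *v v)" for v
  have lin: "linear L"
    unfolding L_def by (intro linear_compose_sum ballI matrix_vector_mul_linear)
  have projL: "\<pi> i (L v) = C i *v \<pi> i v" for i v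
  proof -
    have "L v = (\<Sum>i\<in>UNIV. \<pi> i (C i *v \<pi> i v))"
      unfolding L_def by (intro sum.cong refl C_mult_vec)
    then have "\<pi> i (L v) = \<pi> i (C i *v \<pi> i v)"
      by (simp add: proj_sum_proj)
    also have "\<dots> = C i *v \<pi> i v"
      using C_mult_vec[of i "\<pi> i v"] by (metis proj_proj)
    finally show ?thesis .
  qed
  have "v = 0" if "L v = 0" for v
  proof -
    have "\<pi> i v = 0" for i
      using projL[of i v] that C_nonsing[of i] by (simp add: nonsing_block_def)
    then show ?thesis
      using sum_proj[of blk v] by simp
  qed
  then have "inj L"
    using lin by (simp add: linear_injective_0)
  then obtain D where "linear D" "\<And>v. L (D v) = v"
    using linear_injective_isomorphism[OF lin] by blast
  then show ?thesis
    using projL by metis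
qed

definition D where "D = (SOME D. linear D \<and> (\<forall>v i. \<pi> i v = C i *v \<pi> i (D v)))"

definition wt where "wt i v = norm (\<pi> i (D v))"

lemma D_spec: "linear D \<and> (\<forall>v i. \<pi> i v = C i *v \<pi> i (D v))"
  unfolding D_def by (rule someI_ex[OF ex_block_inverse])

lemma linear_D: "linear D"
  by (rule D_spec[THEN conjunct1])

lemma proj_eq_C_D: "\<pi> i v = C i *v \<pi> i (D v)"
  using D_spec by (elim conjE allE)

lemma wt_nonneg: "0 \<le> wt i v"
  by (simp add: wt_def)

lemma proj_D_eq_0: "\<pi> i v = 0 \<Longrightarrow> \<pi> i (D v) = 0"
  using proj_eq_C_D[of i v] C_nonsing[of i] by (simp add: nonsing_block_def)

text \<open>Although \<open>D\<close> acts on the whole profile, \<open>wt i\<close> depends on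
  block \<open>i\<close> alone, since \<open>C i\<close> is injective on that block.\<close>

lemma wt_cong:
  assumes "\<pi> i v = \<pi> i v'"
  shows "wt i v = wt i v'"
proof -
  have "\<pi> i (D (v - v')) = 0"
    by (rule proj_D_eq_0) (simp add: assms proj_diff)
  then show ?thesis
    by (simp add: wt_def linear_diff[OF linear_D] proj_diff)
qed

lemma wt_eq_0: "\<pi> i v = 0 \<Longrightarrow> wt i v = 0"
  by (simp add: wt_def proj_D_eq_0)

lemma norm_proj_le_wt: "norm (\<pi> i v) \<le> norm2 (C i) * wt i v"
  unfolding wt_def by (subst proj_eq_C_D) (rule norm2_mult_vec)

lemma norm_le_sum_wt: "norm v \<le> (\<Sum>i\<in>UNIV. norm2 (C i) * wt i v)"
proof -
  have "norm (\<Sum>i\<in>UNIV. \<pi> i v) \<le> (\<Sum>i\<in>UNIV. norm2 (C i) * wt i v)"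
    by (intro sum_norm_le norm_proj_le_wt)
  then show ?thesis
    by (simp add: sum_proj)
qed

section \<open>Hessian blocks and their bounds by \<Upsilon>\<close>

definition scaledM where
  "scaledM i j x = transpose (C i) ** blockM blk i j (hess i x) ** C j"

lemma Upsilon_diag: "\<Upsilon> i i = (INF x\<in>QQ. lambda_least blk i (scaledM i i x))"
  by (simp add: Upsilon_def scaledM_def)

lemma Upsilon_off_diag: "i \<noteq> j \<Longrightarrow> \<Upsilon> i j = - (SUP x\<in>QQ. norm2 (scaledM i j x))"
  by (simp add: Upsilon_def scaledM_def)

lemma scaledM_mult_vec:
  "scaledM i j x *v v = transpose (C i) *v \<pi> i (hess i x *v \<pi> j (C j *v v))"
  by (simp add: scaledM_def matrix_vector_mul_assoc[symmetric] blockM_mult_vec)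

text \<open>The change of variables behind \<Upsilon>: the factors \<open>C i\<close> and
  \<open>C j\<close> in the scaled block cancel against the coordinates \<open>D v\<close>, leaving
  the bilinear form of the Hessian itself.\<close>

lemma inner_scaledM:
  "\<pi> i (D v) \<bullet> (scaledM i j x *v \<pi> j (D v)) = \<pi> i v \<bullet> (hess i x *v \<pi> j v)"
proof -
  have "\<pi> i (D v) \<bullet> (scaledM i j x *v \<pi> j (D v))
      = (C i *v \<pi> i (D v)) \<bullet> \<pi> i (hess i x *v \<pi> j (C j *v \<pi> j (D v)))"
    unfolding scaledM_mult_vec by (metis dot_lmul_matrix vector_transpose_matrix transpose_transpose)
  also have "\<dots> = \<pi> i v \<bullet> \<pi> i (hess i x *v \<pi> j v)"
    by (simp add: proj_eq_C_D[symmetric] proj_proj)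
  also have "\<dots> = \<pi> i v \<bullet> (hess i x *v \<pi> j v)"
    by (simp add: inner_proj_left[symmetric] proj_proj)
  finally show ?thesis .
qed

lemma blockM_scaledM: "blockM blk i j (scaledM i j x) = scaledM i j x"
proof -
  have Ct: "transpose (C i) *v v = \<pi> i (transpose (C i) *v \<pi> i v)" for v
    using C_nonsing[of i] blockM_mult_vec[of blk i i "transpose (C i)" v] transpose_blockM[of blk i i "C i"]
    by (simp add: nonsing_block_def)
  have "blockM blk i j (scaledM i j x) *v v = scaledM i j x *v v" for v
    unfolding blockM_mult_vec scaledM_mult_vec
    using C_mult_vec[of j v] C_mult_vec[of j "\<pi> j v"] Ct by (metis proj_proj)
  then show ?thesis
    by (metis matrix_eq)
qed

text \<open>The scaled blocks are a linear image of the bounded set of Hessians. This makes the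
  suprema in \<Upsilon> genuine upper bounds.\<close>

lemma bdd_above_norm2_scaledM: "bdd_above ((\<lambda>x. norm2 (scaledM i j x)) ` QQ)"
proof -
  have "linear (\<lambda>H. transpose (C i) ** blockM blk i j H ** C j)"
  proof (intro linearI)
    fix H H' :: "real^'k^'k" and c :: real
    have "blockM blk i j (H + H') = blockM blk i j H + blockM blk i j H'"
      and s: "blockM blk i j (c *\<^sub>R H) = c *\<^sub>R blockM blk i j H"
      by (auto simp: vec_eq_iff blockM_def)
    then show "transpose (C i) ** blockM blk i j (H + H') ** C j
        = transpose (C i) ** blockM blk i j H ** C j + transpose (C i) ** blockM blk i j H' ** C j"
      by (simp add: vec_eq_iff matrix_matrix_mult_def sum.distrib distrib_right distrib_left)
    show "transpose (C i) ** blockM blk i j (c *\<^sub>R H) ** C j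
        = c *\<^sub>R (transpose (C i) ** blockM blk i j H ** C j)"
      unfolding s by (simp add: matrix_scalar_ac scalar_matrix_assoc)
  qed
  then have "bounded ((\<lambda>H. transpose (C i) ** blockM blk i j H ** C j) ` hess i ` QQ)"
    by (intro bounded_linear_image hess_bdd) (simp add: linear_conv_bounded_linear)
  then obtain K where K: "\<And>x. x \<in> QQ \<Longrightarrow> norm (scaledM i j x) \<le> K"
    unfolding bounded_iff scaledM_def by auto
  show ?thesis
  proof (rule bdd_aboveI2)
    fix x assume "x \<in> QQ"
    then have "real CARD('k) * real CARD('k) * norm (scaledM i j x) \<le> real CARD('k) * real CARD('k) * K"
      by (intro mult_left_mono K) auto
    then show "norm2 (scaledM i j x) \<le> real CARD('k) * real CARD('k) * K"
      using norm2_le_norm order_trans by blast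
  qed
qed

lemma Upsilon_diag_le:
  assumes "x \<in> QQ"
  shows "\<Upsilon> i i \<le> lambda_least blk i (scaledM i i x)"
proof -
  obtain K where K: "\<And>x. x \<in> QQ \<Longrightarrow> norm2 (scaledM i i x) \<le> K"
    using bdd_above_norm2_scaledM[of i i] by (auto simp: bdd_above_def)
  have "- K \<le> lambda_least blk i (scaledM i i x)" if "x \<in> QQ" for x
    using K[OF that] lambda_least_bounds(2)[OF blocks_nonempty blockM_scaledM[of i i x]] by linarith
  then show ?thesis
    unfolding Upsilon_diag using assms by (intro cINF_lower bdd_belowI2) auto
qed

lemma Upsilon_off_diag_le:
  assumes "x \<in> QQ" "i \<noteq> j"
  shows "\<Upsilon> i j \<le> - norm2 (scaledM i j x)"
  unfolding Upsilon_off_diag[OF assms(2)] neg_le_iff_le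
  by (rule cSUP_upper[OF assms(1) bdd_above_norm2_scaledM])

lemma Upsilon_off_diag_nonpos:
  assumes "i \<noteq> j"
  shows "\<Upsilon> i j \<le> 0"
proof -
  obtain x where "x \<in> QQ" using prodQ_nonempty by blast
  then show ?thesis
    using Upsilon_off_diag_le[OF _ assms] norm2_nonneg[of "scaledM i j x"] by fastforce
qed

text \<open>Pairing the gradient with the fixed vector \<open>\<pi> i (x - y)\<close> makes it
  scalar, so the mean value theorem supplies one point \<open>z\<close> of the segment that serves
  all blocks \<open>j\<close>. The Hessian terms at \<open>z\<close> are then bounded below by the
  least eigenvalue for \<open>j = i\<close>, and by Cauchy-Schwarz with the operator norm for the
  others.\<close>

lemma grad_monotone_bound:
  assumes x: "x \<in> QQ" and y: "y \<in> QQ"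
  shows "wt i (x - y) * (\<Sum>j\<in>UNIV. \<Upsilon> i j * wt j (x - y)) \<le> \<pi> i (x - y) \<bullet> (grad i x - grad i y)"
proof -
  let ?v = "x - y"
  have deriv: "((\<lambda>z. \<pi> i ?v \<bullet> grad i z) has_derivative (\<lambda>h. \<pi> i ?v \<bullet> (hess i z *v h))) (at z)"
    if "z \<in> QQ" for z
    using hess[OF that, of i] by (rule has_derivative_inner_right)
  have seg: "y + t *\<^sub>R ?v \<in> QQ" if "0 \<le> t" "t \<le> 1" for t
    using that x y by (intro prodQ_segment) auto
  obtain t where t: "0 < t" "t < 1"
    and eq: "\<pi> i ?v \<bullet> grad i (y + ?v) - \<pi> i ?v \<bullet> grad i y = \<pi> i ?v \<bullet> (hess i (y + t *\<^sub>R ?v) *v ?v)"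
    by (rule segment_mean_value[where f="\<lambda>z. \<pi> i ?v \<bullet> grad i z" and x=y and h="?v"
          and f'="\<lambda>z h. \<pi> i ?v \<bullet> (hess i z *v h)"])
       (use deriv[OF seg] in auto)
  define z where "z = y + t *\<^sub>R ?v"
  have z: "z \<in> QQ"
    unfolding z_def using t by (intro seg) auto
  have "wt i ?v * (\<Sum>j\<in>UNIV. \<Upsilon> i j * wt j ?v) = (\<Sum>j\<in>UNIV. \<Upsilon> i j * (wt i ?v * wt j ?v))"
    by (simp add: sum_distrib_left mult_ac)
  also have "\<dots> \<le> (\<Sum>j\<in>UNIV. \<pi> i ?v \<bullet> (hess i z *v \<pi> j ?v))"
  proof (rule sum_mono)
    fix j
    let ?a = "\<pi> i (D ?v)" and ?b = "\<pi> j (D ?v)"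
    have "\<Upsilon> i j * (norm ?a * norm ?b) \<le> ?a \<bullet> (scaledM i j z *v ?b)"
    proof (cases "i = j")
      case True
      have "\<Upsilon> i i * (norm ?a)\<^sup>2 \<le> lambda_least blk i (scaledM i i z) * (norm ?a)\<^sup>2"
        by (intro mult_right_mono Upsilon_diag_le z) auto
      also have "\<dots> \<le> ?a \<bullet> (scaledM i i z *v ?a)"
        by (intro lambda_least_bounds blocks_nonempty blockM_scaledM proj_in_blocksp)
      finally show ?thesis
        using True by (simp add: power2_eq_square)
    next
      case False
      have "\<Upsilon> i j * (norm ?a * norm ?b) \<le> - norm2 (scaledM i j z) * (norm ?a * norm ?b)"
        by (intro mult_right_mono Upsilon_off_diag_le z False) auto
      also have "\<dots> \<le> - (norm ?a * norm (scaledM i j z *v ?b))"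
        using mult_left_mono[OF norm2_mult_vec[of "scaledM i j z" ?b], of "norm ?a"]
        by (simp add: mult_ac)
      also have "\<dots> \<le> ?a \<bullet> (scaledM i j z *v ?b)"
        using Cauchy_Schwarz_ineq2[of ?a "scaledM i j z *v ?b"] by linarith
      finally show ?thesis .
    qed
    then show "\<Upsilon> i j * (wt i ?v * wt j ?v) \<le> \<pi> i ?v \<bullet> (hess i z *v \<pi> j ?v)"
      by (simp add: wt_def inner_scaledM)
  qed
  also have "\<dots> = \<pi> i ?v \<bullet> (hess i z *v (\<Sum>j\<in>UNIV. \<pi> j ?v))"
    by (simp add: inner_sum_right linear_sum[OF matrix_vector_mul_linear])
  also have "\<dots> = \<pi> i ?v \<bullet> (grad i x - grad i y)"
    using eq by (simp add: sum_proj z_def inner_diff_right)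
  finally show ?thesis .
qed

text \<open>When only block \<open>i\<close> differs the cross terms vanish. As
  \<open>\<Upsilon> i i\<close> is positive, this is strong monotonicity in the player's own
  variable.\<close>

lemma grad_monotone_own_block:
  assumes "x \<in> QQ" "y \<in> QQ" and v: "x - y \<in> blocksp blk i"
  shows "\<Upsilon> i i * (wt i (x - y))\<^sup>2 \<le> (x - y) \<bullet> (grad i x - grad i y)"
proof -
  have "(\<Sum>j\<in>UNIV. \<Upsilon> i j * wt j (x - y)) = \<Upsilon> i i * wt i (x - y) + (\<Sum>j\<in>UNIV - {i}. \<Upsilon> i j * wt j (x - y))"
    by (intro sum.remove) auto
  also have "(\<Sum>j\<in>UNIV - {i}. \<Upsilon> i j * wt j (x - y)) = 0"
    using proj_blocksp_other[OF v] by (intro sum.neutral) (auto simp: wt_eq_0)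
  finally show ?thesis
    using grad_monotone_bound[OF assms(1,2), of i] v
    by (simp add: proj_eq_iff[THEN iffD2] power2_eq_square mult_ac)
qed

section \<open>Compactness and existence of an equilibrium\<close>

lemma Upsilon_diag_pos: "0 < \<Upsilon> i i"
  by (rule P_matrix_diagonal_pos[OF P_mat])

text \<open>Strong monotonicity of a bounded gradient is only possible on a bounded set, so boundedness of
  the first derivatives makes the strategy sets compact.\<close>

lemma bounded_Q: "bounded (Q i)"
proof -
  obtain x where x: "x \<in> QQ" using prodQ_nonempty by blast
  obtain G where G: "\<And>z. z \<in> QQ \<Longrightarrow> norm (grad i z) \<le> G"
    using grad_bdd[of i] by (auto simp: bounded_iff)
  \<comment> \<open>Strong monotonicity bounds \<open>\<Upsilon> i i\<close> times the square of the
    weight by the weight times \<open>norm2 (C i) * (2 * G)\<close>; dividing out one weight and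
    \<open>\<Upsilon> i i\<close> leaves \<open>K\<close>.\<close>
  define K where "K = norm2 (C i) * (2 * G) / \<Upsilon> i i"
  have G0: "0 \<le> G"
    using G[OF x] norm_ge_zero order_trans by blast
  have "dist (\<pi> i x) y \<le> norm2 (C i) * K" if y: "y \<in> Q i" for y
  proof -
    define z where "z = y + (x - \<pi> i x)"
    have z: "z \<in> QQ"
      unfolding z_def by (rule prodQ_replace[OF x y])
    have zx: "z - x = y - \<pi> i x"
      by (simp add: z_def)
    have b: "z - x \<in> blocksp blk i"
      unfolding zx using y Q_sub by (intro subspace_diff subspace_blocksp) auto
    have "\<Upsilon> i i * (wt i (z - x))\<^sup>2 \<le> (z - x) \<bullet> (grad i z - grad i x)"
      by (rule grad_monotone_own_block[OF z x b])
    also have "\<dots> \<le> norm (z - x) * norm (grad i z - grad i x)"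
      by (rule norm_cauchy_schwarz)
    also have "\<dots> \<le> (norm2 (C i) * wt i (z - x)) * (2 * G)"
    proof (rule mult_mono)
      show "norm (z - x) \<le> norm2 (C i) * wt i (z - x)"
        using norm_proj_le_wt[of i "z - x"] b by (simp add: proj_eq_iff[THEN iffD2])
      show "norm (grad i z - grad i x) \<le> 2 * G"
        using norm_triangle_ineq4[of "grad i z" "grad i x"] G[OF z] G[OF x] by linarith
    qed (auto simp: norm2_nonneg wt_nonneg)
    finally have "wt i (z - x) * (\<Upsilon> i i * wt i (z - x)) \<le> wt i (z - x) * (norm2 (C i) * (2 * G))"
      by (simp add: power2_eq_square mult_ac)
    then have "wt i (z - x) \<le> K"
      using Upsilon_diag_pos[of i] wt_nonneg[of i "z - x"] G0 norm2_nonneg[of "C i"]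
      by (cases "wt i (z - x) = 0") (auto simp: K_def pos_le_divide_eq mult_ac)
    then have "norm2 (C i) * wt i (z - x) \<le> norm2 (C i) * K"
      by (intro mult_left_mono norm2_nonneg)
    then show ?thesis
      using norm_proj_le_wt[of i "z - x"] b zx
      by (simp add: proj_eq_iff[THEN iffD2] dist_norm norm_minus_commute)
  qed
  then show ?thesis
    unfolding bounded_def by blast
qed

lemma compact_prodQ: "compact QQ"
proof -
  obtain K where K: "\<And>i y. y \<in> Q i \<Longrightarrow> norm y \<le> K i"
    using bounded_Q unfolding bounded_iff by metis
  have "norm x \<le> (\<Sum>i\<in>UNIV. K i)" if "x \<in> QQ" for x
  proof -
    have "norm (\<Sum>i\<in>UNIV. \<pi> i x) \<le> (\<Sum>i\<in>UNIV. K i)"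
      using that by (intro sum_norm_le K) (auto simp: prodQ_def)
    then show ?thesis by (simp add: sum_proj)
  qed
  then have "bounded QQ"
    by (auto simp: bounded_iff)
  then show ?thesis
    using closed_prodQ by (simp add: compact_eq_bounded_closed)
qed

text \<open>A fixed point of the projected gradient map solves the variational inequality of the game.\<close>

lemma ex_variational_solution:
  obtains x where "x \<in> QQ" and "\<And>i y. y \<in> Q i \<Longrightarrow> 0 \<le> grad i x \<bullet> (y - \<pi> i x)"
proof -
  define F where "F x = (\<Sum>i\<in>UNIV. \<pi> i (grad i x))" for x
  have "continuous_on QQ (grad i)" for i
    using hess has_derivative_continuous continuous_at_imp_continuous_on by blast
  then have cont: "continuous_on QQ F"
    unfolding F_def
    by (intro continuous_on_sum bounded_linear.continuous_on[OF linear_conv_bounded_linear[THEN iffD1, OF linear_proj]])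
  have "continuous_on QQ (\<lambda>x. closest_point QQ (x - F x))"
    by (rule continuous_on_compose2[OF continuous_on_closest_point[OF convex_prodQ closed_prodQ prodQ_nonempty, of UNIV]])
       (auto intro!: continuous_intros cont)
  moreover have "(\<lambda>x. closest_point QQ (x - F x)) \<in> QQ \<rightarrow> QQ"
    using closest_point_in_set[OF closed_prodQ prodQ_nonempty] by auto
  ultimately obtain x where x: "x \<in> QQ" and fp: "closest_point QQ (x - F x) = x"
    using brouwer[OF compact_prodQ convex_prodQ prodQ_nonempty] by blast
  show thesis
  proof (rule that[OF x])
    fix i y assume y: "y \<in> Q i"
    have "y + (x - \<pi> i x) \<in> QQ"
      by (rule prodQ_replace[OF x y])
    \<comment> \<open>At a fixed point the obtuse-angle property of the projection is the
      variational inequality. The test profile differs from \<open>x\<close> only in block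
      \<open>i\<close>, so only that block of \<open>F x\<close> contributes.\<close>
    from closest_point_dot[OF convex_prodQ closed_prodQ this, of "x - F x"]
    have "0 \<le> F x \<bullet> (y - \<pi> i x)"
      by (simp add: fp)
    also have "y - \<pi> i x = \<pi> i (y - \<pi> i x)"
      using y by (simp add: proj_diff proj_proj proj_Q)
    also have "F x \<bullet> \<pi> i (y - \<pi> i x) = \<pi> i (grad i x) \<bullet> (y - \<pi> i x)"
      by (simp add: F_def inner_proj_left[symmetric] proj_sum_proj)
    also have "\<dots> = grad i x \<bullet> (y - \<pi> i x)"
      using y by (simp add: inner_proj_left proj_diff proj_proj proj_Q)
    finally show "0 \<le> grad i x \<bullet> (y - \<pi> i x)" .
  qed
qed

text \<open>For a deviation \<open>h\<close> in block \<open>i\<close>, the mean value theorem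
  writes the change of \<open>f i\<close> as a directional derivative at a point between. By
  monotonicity in the own block it is at least the derivative at \<open>x\<close>, which the
  variational inequality makes nonnegative.\<close>

lemma ex_NE: "\<exists>x. is_NE blk Q f x"
proof -
  obtain x where x: "x \<in> QQ" and vi: "\<And>i y. y \<in> Q i \<Longrightarrow> 0 \<le> grad i x \<bullet> (y - \<pi> i x)"
    using ex_variational_solution by blast
  have "f i x \<le> f i (y + (x - \<pi> i x))" if y: "y \<in> Q i" for i y
  proof -
    define h where "h = y - \<pi> i x"
    have xh: "y + (x - \<pi> i x) = x + h"
      by (simp add: h_def)
    have hb: "h \<in> blocksp blk i"
      unfolding h_def using y Q_sub by (intro subspace_diff subspace_blocksp) auto
    have seg: "x + t *\<^sub>R h \<in> QQ" if "0 \<le> t" "t \<le> 1" for t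
      using that x prodQ_replace[OF x y] by (intro prodQ_segment) (auto simp: xh)
    obtain t where t: "0 < t" "t < 1" and eq: "f i (x + h) - f i x = grad i (x + t *\<^sub>R h) \<bullet> h"
      by (rule segment_mean_value[where f="f i" and f'="\<lambda>z h. grad i z \<bullet> h" and x=x and h=h])
         (use grad[OF seg, of _ i] in auto)
    have z: "x + t *\<^sub>R h \<in> QQ"
      using t by (intro seg) auto
    have "0 \<le> \<Upsilon> i i * (wt i (x + t *\<^sub>R h - x))\<^sup>2"
      using Upsilon_diag_pos[of i] by simp
    also have "\<dots> \<le> (x + t *\<^sub>R h - x) \<bullet> (grad i (x + t *\<^sub>R h) - grad i x)"
      using hb by (intro grad_monotone_own_block z x) (simp add: subspace_scale subspace_blocksp)
    finally have "0 \<le> h \<bullet> (grad i (x + t *\<^sub>R h) - grad i x)"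
      using t by (simp add: zero_le_mult_iff)
    then have "grad i x \<bullet> h \<le> grad i (x + t *\<^sub>R h) \<bullet> h"
      by (simp add: inner_diff_right inner_commute)
    moreover have "0 \<le> grad i x \<bullet> h"
      unfolding h_def by (rule vi[OF y])
    ultimately show ?thesis
      unfolding xh using eq by linarith
  qed
  then show ?thesis
    using x unfolding is_NE_def by blast
qed

section \<open>Convergence of asynchronous best responses and uniqueness\<close>

lemma best_response_variational:
  assumes x: "x \<in> QQ" and min: "\<And>z. z \<in> Q i \<Longrightarrow> f i x \<le> f i (z + (x - \<pi> i x))" and y: "y \<in> Q i"
  shows "0 \<le> grad i x \<bullet> (y - \<pi> i x)"
proof (rule minimum_first_order[OF grad[OF x]])
  fix t :: real assume t: "0 \<le> t" "t \<le> 1"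
  have "\<pi> i x \<in> Q i"
    using x by (simp add: prodQ_def)
  then have "(1 - t) *\<^sub>R \<pi> i x + t *\<^sub>R y \<in> Q i"
    using Q_convex[of i] y t by (simp add: convex_alt)
  from min[OF this] show "f i x \<le> f i (x + t *\<^sub>R (y - \<pi> i x))"
    by (simp add: algebra_simps)
qed

text \<open>Each of the two variational inequalities is tested with the other profile's block
  \<open>i\<close>. Their sum bounds the gradient pairing above by 0, while
  \<open>grad_monotone_bound\<close> bounds it below.\<close>

lemma best_response_bound:
  assumes x: "x \<in> QQ" and minx: "\<And>z. z \<in> Q i \<Longrightarrow> f i x \<le> f i (z + (x - \<pi> i x))"
    and y: "y \<in> QQ" and miny: "\<And>z. z \<in> Q i \<Longrightarrow> f i y \<le> f i (z + (y - \<pi> i y))"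
  shows "wt i (x - y) * (\<Sum>j\<in>UNIV. \<Upsilon> i j * wt j (x - y)) \<le> 0"
proof -
  have xy: "\<pi> i x \<in> Q i" "\<pi> i y \<in> Q i"
    using x y by (auto simp: prodQ_def)
  have "0 \<le> grad i x \<bullet> (\<pi> i y - \<pi> i x)" "0 \<le> grad i y \<bullet> (\<pi> i x - \<pi> i y)"
    using best_response_variational[OF x minx xy(2)] best_response_variational[OF y miny xy(1)] by auto
  then have "\<pi> i (x - y) \<bullet> (grad i x - grad i y) \<le> 0"
    by (simp add: proj_diff inner_diff_left inner_diff_right inner_commute)
  then show ?thesis
    using grad_monotone_bound[OF x y, of i] by linarith
qed

text \<open>The errors \<open>wt i (x n - xs) / d i\<close> satisfy the abstract asynchronous
  contraction: both the updated profile and \<open>xs\<close> are best responses in block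
  \<open>i\<close>, so \<open>best_response_bound\<close> applies to their difference.\<close>

lemma async_BR_converges:
  assumes NE: "is_NE blk Q f xs" and sched: "schedule_ok T tau" and x: "async_BR_seq blk Q f T tau x"
  shows "x \<longlonglongrightarrow> xs"
proof -
  have xs: "xs \<in> QQ" and xs_min: "\<And>i z. z \<in> Q i \<Longrightarrow> f i xs \<le> f i (z + (xs - \<pi> i xs))"
    using NE by (auto simp: is_NE_def)
  have keep: "\<pi> i (x (Suc n)) = \<pi> i (x n)" if "n \<notin> T i" for i n
    using x that by (simp add: async_BR_seq_def)
  have upd: "\<pi> i (x (Suc n)) \<in> Q i"
    "\<And>z. z \<in> Q i \<Longrightarrow> f i (\<pi> i (x (Suc n)) + (\<Sum>j\<in>UNIV - {i}. \<pi> j (x (tau i j n))))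
        \<le> f i (z + (\<Sum>j\<in>UNIV - {i}. \<pi> j (x (tau i j n))))" if "n \<in> T i" for i n
    using x that by (simp_all add: async_BR_seq_def Let_def)
  have xQ: "\<pi> i (x n) \<in> Q i" for i n
  proof (induction n)
    case 0
    then show ?case using x by (simp add: async_BR_seq_def prodQ_def)
  next
    case (Suc n)
    then show ?case using keep[of n i] upd(1)[of n i] by (cases "n \<in> T i") auto
  qed
  obtain d \<rho> where d: "\<And>i. 0 < d i" and rho: "0 \<le> \<rho>" "\<rho> < 1"
    and contr: "\<And>i w B. \<lbrakk>\<And>j. 0 \<le> w j; w i * (\<Sum>j\<in>UNIV. \<Upsilon> i j * w j) \<le> 0; 0 \<le> B;
           \<And>j. j \<noteq> i \<Longrightarrow> w j \<le> B * d j\<rbrakk> \<Longrightarrow> w i \<le> \<rho> * B * d i"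
    using P_matrix_Z_matrix_contraction[OF P_mat Upsilon_off_diag_nonpos] by blast
  have lim: "(\<lambda>n. wt i (x n - xs) / d i) \<longlonglongrightarrow> 0" for i
  proof (rule async_contraction_tendsto_0[OF sched rho, where u="\<lambda>i n. wt i (x n - xs) / d i"])
    show "0 \<le> wt i (x n - xs) / d i" for i n
      using wt_nonneg d by (simp add: less_imp_le)
    show "wt i (x (Suc n) - xs) / d i = wt i (x n - xs) / d i" if "n \<notin> T i" for i n
      using keep[OF that] wt_cong[of i "x (Suc n) - xs" "x n - xs"] by (simp add: proj_diff)
    fix i n and B :: real
    assume n: "n \<in> T i" and B: "0 \<le> B"
      and le: "\<And>j. j \<noteq> i \<Longrightarrow> wt j (x (tau i j n) - xs) / d j \<le> B"
    \<comment> \<open>The profile player \<open>i\<close> actually optimizes at time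
      \<open>n\<close>: its new block joined with outdated blocks of the others. It need not be an
      iterate, but its block \<open>i\<close> agrees with that of \<open>x (Suc n)\<close>.\<close>
    define p where "p = \<pi> i (x (Suc n)) + (\<Sum>j\<in>UNIV - {i}. \<pi> j (x (tau i j n)))"
    have p: "p \<in> QQ" "\<pi> i p = \<pi> i (x (Suc n))" "\<And>j. j \<noteq> i \<Longrightarrow> \<pi> j p = \<pi> j (x (tau i j n))"
      unfolding p_def using prodQ_combine[of "\<pi> i (x (Suc n))" i "\<lambda>j. x (tau i j n)"] xQ by auto
    have oth: "(\<Sum>j\<in>UNIV - {i}. \<pi> j (x (tau i j n))) = p - \<pi> i p"
      unfolding p(2) by (simp add: p_def)
    have "f i p \<le> f i (z + (p - \<pi> i p))" if "z \<in> Q i" for z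
      using upd(2)[OF n that] unfolding oth unfolding p(2)[symmetric] by simp
    then have "wt i (p - xs) * (\<Sum>j\<in>UNIV. \<Upsilon> i j * wt j (p - xs)) \<le> 0"
      by (rule best_response_bound[OF p(1) _ xs xs_min])
    moreover have "wt j (p - xs) \<le> B * d j" if "j \<noteq> i" for j
      using le[OF that] d[of j] wt_cong[of j "p - xs" "x (tau i j n) - xs"] p(3)[OF that]
      by (simp add: proj_diff pos_divide_le_eq)
    ultimately have "wt i (p - xs) \<le> \<rho> * B * d i"
      using contr[of "\<lambda>j. wt j (p - xs)" i B] wt_nonneg B by blast
    then show "wt i (x (Suc n) - xs) / d i \<le> \<rho> * B"
      using d[of i] wt_cong[of i "p - xs" "x (Suc n) - xs"] p(2)
      by (simp add: proj_diff pos_divide_le_eq)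
  qed
  have "(\<lambda>n. wt i (x n - xs)) \<longlonglongrightarrow> 0" for i
  proof -
    have "(\<lambda>n. wt i (x n - xs) / d i * d i) \<longlonglongrightarrow> 0 * d i"
      by (intro tendsto_mult lim tendsto_const)
    then show ?thesis
      using d[of i] by simp
  qed
  then have "(\<lambda>n. \<Sum>i\<in>UNIV. norm2 (C i) * wt i (x n - xs)) \<longlonglongrightarrow> (\<Sum>i\<in>UNIV. norm2 (C i) * 0)"
    by (intro tendsto_sum tendsto_mult tendsto_const)
  then have "(\<lambda>n. \<Sum>i\<in>UNIV. norm2 (C i) * wt i (x n - xs)) \<longlonglongrightarrow> 0"
    by simp
  then have "(\<lambda>n. x n - xs) \<longlonglongrightarrow> 0"
    by (rule Lim_null_comparison[rotated]) (simp add: norm_le_sum_wt)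
  then show ?thesis
    by (rule LIM_zero_cancel)
qed

text \<open>An equilibrium played forever is itself a best-response sequence, so convergence of all such
  sequences to a given equilibrium forces uniqueness.\<close>

lemma NE_unique:
  assumes xs: "is_NE blk Q f xs" and y: "is_NE blk Q f y"
  shows "y = xs"
proof -
  \<comment> \<open>Every player updates at every step with current information, so the delays are
    trivial.\<close>
  have "schedule_ok (\<lambda>_::'p. UNIV) (\<lambda>_ _ n. n)"
    by (auto simp: schedule_ok_def)
  moreover have "async_BR_seq blk Q f (\<lambda>_. UNIV) (\<lambda>_ _ n. n) (\<lambda>_. y)"
    using y by (auto simp: async_BR_seq_def is_NE_def sum_proj_others prodQ_def Let_def)
  ultimately have "(\<lambda>_. y) \<longlonglongrightarrow> xs"
    by (rule async_BR_converges[OF xs])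
  then show ?thesis
    by (simp add: LIMSEQ_const_iff)
qed

end

theorem mainTheorem3:
  fixes blk :: "'k::finite \<Rightarrow> 'p::finite"
    and Q :: "'p \<Rightarrow> (real^'k) set"
    and f :: "'p \<Rightarrow> real^'k \<Rightarrow> real"
    and U :: "'p \<Rightarrow> (real^'k) set"
    and grad :: "'p \<Rightarrow> real^'k \<Rightarrow> real^'k"
    and hess :: "'p \<Rightarrow> real^'k \<Rightarrow> real^'k^'k"
    and C :: "'p \<Rightarrow> real^'k^'k"
  assumes blocks_nonempty: "surj blk"
    and Q_sub: "\<And>i. Q i \<subseteq> blocksp blk i"
    and Q_ne: "\<And>i. Q i \<noteq> {}"
    and Q_closed: "\<And>i. closed (Q i)"
    and Q_convex: "\<And>i. convex (Q i)"
    and U_open: "\<And>i. open (U i)"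
    and U_sup: "\<And>i. prodQ blk Q \<subseteq> U i"
    and grad: "\<And>i x. x \<in> U i \<Longrightarrow> (f i has_derivative (\<lambda>h. grad i x \<bullet> h)) (at x)"
    and hess: "\<And>i x. x \<in> U i \<Longrightarrow> (grad i has_derivative (\<lambda>h. hess i x *v h)) (at x)"
    and hess_cont: "\<And>i. continuous_on (U i) (hess i)"
    and grad_bdd: "\<And>i. bounded (grad i ` prodQ blk Q)"
    and hess_bdd: "\<And>i. bounded (hess i ` prodQ blk Q)"
    and f_convex: "\<And>i x. x \<in> prodQ blk Q \<Longrightarrow>
                     convex_on (Q i) (\<lambda>y. f i (y + (x - proj blk i x)))"
    and C_nonsing: "\<And>i. nonsing_block blk i (C i)"
    and P_mat: "P_matrix (Upsilon blk Q hess C)"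
  shows "\<exists>xs. is_NE blk Q f xs \<and> (\<forall>y. is_NE blk Q f y \<longrightarrow> y = xs) \<and>
           (\<forall>T tau x. schedule_ok T tau \<longrightarrow> async_BR_seq blk Q f T tau x \<longrightarrow>
                x \<longlonglongrightarrow> xs)"
proof -
  \<comment> \<open>The derivatives given on the open sets \<open>U i\<close> are restricted to the
    points of \<open>prodQ blk Q\<close>.\<close>
  interpret P_Upsilon_NEP blk Q f grad hess C
  proof
    show "(f i has_derivative (\<lambda>h. grad i x \<bullet> h)) (at x)" if "x \<in> prodQ blk Q" for i x
      using grad U_sup that by blast
    show "(grad i has_derivative (\<lambda>h. hess i x *v h)) (at x)" if "x \<in> prodQ blk Q" for i x
      using hess U_sup that by blast
  qed (fact assms)+
  show ?thesis
    using ex_NE NE_unique async_BR_converges by blast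
qed

end
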